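(* Let $E$ and $F$ be two Banach lattices and let $T : E \to F$ be an operator with adjoint $T' : F' \to E'$. Then the following hold: (1) $T$ is order M-weakly compact if and only if its adjoint $T'$ is order L-weakly compact. (2) If its adjoint $T'$ is order M-weakly compact, then $T$ is order L-weakly compact.
   Context: All Banach spaces and Banach lattices are real; "operator" means bounded linear map; $G'$ denotes the topological dual of $G$ (a Banach lattice when $G$ is one); $B_G$ is the closed unit ball of $G$. A nonempty bounded subset $A$ of a Banach lattice $G$ is L-weakly compact if $\lim\|x_n\|=0$ for every disjoint sequence $(x_n)$ in the solid hull of $A$. An operator $T : G \to H$ between Banach lattices is order L-weakly compact if $T[0,x]$ is an L-weakly compact subset of $H$ for each $x\in G^+$. An operator $T : G \to H$ between Banach lattices is order M-weakly compact if $f_n(T(x_n))\to 0$ for every disjoint sequence $(x_n)$ in $B_G$ and every order bounded sequence $(f_n)$ of $H'$. *)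

theory Defs
  imports "HOL-Analysis.Analysis" "HOL-Library.Lattice_Algebras"
begin

section \<open>Banach lattices\<close>

class banach_lattice = banach + ordered_real_vector + lattice_ab_group_add_abs +
  assumes norm_mono_abs: "\<bar>x\<bar> \<le> \<bar>y\<bar> \<Longrightarrow> norm x \<le> norm y"

instance real :: banach_lattice
  by standard simp

section \<open>The dual Banach lattice\<close>

text \<open>
  The topological dual of \<open>'a\<close> is the type \<open>'a \<Rightarrow>\<^sub>L real\<close> with the operator norm. We equip it
  with the order \<open>f \<le> g \<longleftrightarrow> (\<forall>x\<ge>0. f x \<le> g x)\<close> and show, by the Riesz-Kantorovich construction,
  that it is a Banach lattice. A type class instance cannot mention the type \<open>real\<close> as codomain,
  so the codomain is described by a class of which \<open>real\<close> is an instance: Dedekind complete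
  Banach lattices whose closed unit ball is \<open>{- u..u}\<close> for some \<open>u\<close>.
\<close>

class unital_banach_lattice = banach_lattice + conditionally_complete_lattice +
  assumes ex_order_unit: "\<exists>u. norm u \<le> 1 \<and> (\<forall>x. \<bar>x\<bar> \<le> norm x *\<^sub>R u)"

instance real :: unital_banach_lattice
  by standard (auto intro!: exI[of _ 1])

lemma norm_mono_nonneg:
  fixes x y :: "'a::banach_lattice"
  assumes "0 \<le> x" "x \<le> y"
  shows "norm x \<le> norm y"
  using assms by (intro norm_mono_abs) simp

lemma norm_abs_eq: "norm \<bar>x\<bar> = norm (x::'a::banach_lattice)"
  by (intro antisym norm_mono_abs) simp_all

lemma pprt_diff: "pprt x - pprt (- x) = (x::'a::banach_lattice)"
  using prts[of x] by (simp add: pprt_neg)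

lemma pprt_add: "pprt x + pprt (- x) = \<bar>x::'a::banach_lattice\<bar>"
  by (simp add: abs_prts pprt_neg)

lemma norm_pprt_le: "norm (pprt x) \<le> norm (x::'a::banach_lattice)"
proof -
  have "0 \<le> pprt (- x)" by simp
  then have "pprt x \<le> \<bar>x\<bar>" unfolding pprt_add[of x, symmetric]
    by (simp add: add_increasing2)
  then have "norm (pprt x) \<le> norm \<bar>x\<bar>" by (intro norm_mono_nonneg) simp_all
  then show ?thesis by (simp add: norm_abs_eq)
qed

definition order_unit :: "'a::unital_banach_lattice"
  where "order_unit = (SOME u. norm u \<le> 1 \<and> (\<forall>x. \<bar>x\<bar> \<le> norm x *\<^sub>R u))"

lemma order_unit: "norm (order_unit :: 'a::unital_banach_lattice) \<le> 1"
  "\<bar>x\<bar> \<le> norm x *\<^sub>R (order_unit :: 'a::unital_banach_lattice)"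
  using someI_ex[OF ex_order_unit[where 'a='a], folded order_unit_def] by auto

lemma order_unit_nonneg: "0 \<le> (order_unit :: 'a::unital_banach_lattice)"
proof (cases "\<exists>x::'a. x \<noteq> 0")
  case True
  then obtain x :: 'a where x: "x \<noteq> 0" by blast
  have "0 \<le> norm x *\<^sub>R (order_unit::'a)"
    using order_unit(2)[of x] abs_ge_zero[of x] by (rule order_trans[rotated])
  then have "0 \<le> inverse (norm x) *\<^sub>R (norm x *\<^sub>R (order_unit::'a))"
    by (rule scaleR_nonneg_nonneg[rotated]) simp
  also have "\<dots> = order_unit" using x by (simp only: scaleR_scaleR) simp
  finally show ?thesis .
next
  case False
  then have "(order_unit::'a) = 0" by blast
  then show ?thesis by simp
qed

lemma abs_le_unit:
  assumes "norm x \<le> c"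
  shows "\<bar>x\<bar> \<le> c *\<^sub>R (order_unit :: 'a::unital_banach_lattice)"
  using order_unit(2)[of x] scaleR_right_mono[OF assms order_unit_nonneg] by (rule order_trans)

lemma le_unit:
  assumes "norm x \<le> c"
  shows "x \<le> c *\<^sub>R (order_unit :: 'a::unital_banach_lattice)"
  using abs_ge_self abs_le_unit[OF assms] by (rule order_trans)

lemma norm_le_if_abs_le_unit:
  assumes "\<bar>x\<bar> \<le> c *\<^sub>R (order_unit :: 'a::unital_banach_lattice)" "0 \<le> c"
  shows "norm x \<le> c"
proof -
  have "norm x \<le> norm (c *\<^sub>R (order_unit::'a))"
    using assms scaleR_nonneg_nonneg[OF assms(2) order_unit_nonneg[where 'a='a]]
    by (intro norm_mono_abs) simp
  also have "\<dots> \<le> c" using mult_left_mono[OF order_unit(1)[where 'a='a] assms(2)] assms(2) by simp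
  finally show ?thesis .
qed

text \<open>For \<open>x \<ge> 0\<close>, \<open>rk f x\<close> is the value of the positive part of \<open>f\<close> at \<open>x\<close>.\<close>

definition rk :: "('a::banach_lattice \<Rightarrow>\<^sub>L 'b::unital_banach_lattice) \<Rightarrow> 'a \<Rightarrow> 'b"
  where "rk f x = (SUP z\<in>{0..x}. f z)"

lemma norm_blinfun_interval:
  assumes "0 \<le> z" "z \<le> x"
  shows "norm (blinfun_apply f (z::'a::banach_lattice)) \<le> norm f * norm x"
  using norm_blinfun[of f z] mult_left_mono[OF norm_mono_nonneg[OF assms] norm_ge_zero[of f]]
  by linarith

lemma rk_bdd: "bdd_above ((\<lambda>z. blinfun_apply f z) ` {0..x})"
  for f :: "'a::banach_lattice \<Rightarrow>\<^sub>L 'b::unital_banach_lattice"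
  by (intro bdd_aboveI2[where M="(norm f * norm x) *\<^sub>R order_unit"] le_unit
      norm_blinfun_interval) auto

lemma rk_upper: "0 \<le> z \<Longrightarrow> z \<le> x \<Longrightarrow> blinfun_apply f z \<le> rk f x"
  unfolding rk_def by (intro cSUP_upper rk_bdd) auto

lemma rk_least:
  assumes "0 \<le> x" "\<And>z. 0 \<le> z \<Longrightarrow> z \<le> x \<Longrightarrow> blinfun_apply f z \<le> b"
  shows "rk f x \<le> b"
  unfolding rk_def using assms by (intro cSUP_least) auto

lemma rk_nonneg: "0 \<le> x \<Longrightarrow> 0 \<le> rk f x"
  using rk_upper[of 0 x f] by simp

lemma rk_norm:
  assumes "0 \<le> x"
  shows "norm (rk f x) \<le> norm f * norm x"
proof (rule norm_le_if_abs_le_unit)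
  show "\<bar>rk f x\<bar> \<le> (norm f * norm x) *\<^sub>R order_unit"
    unfolding abs_of_nonneg[OF rk_nonneg[OF assms]]
    using assms by (intro rk_least le_unit norm_blinfun_interval)
qed simp

lemma rk_add:
  assumes "0 \<le> x" "0 \<le> y"
  shows "rk f (x + y) = rk f x + rk f y"
proof (rule antisym)
  show "rk f (x + y) \<le> rk f x + rk f y"
  proof (rule rk_least)
    fix z assume z: "0 \<le> z" "z \<le> x + y"
    have "z - inf z x = sup 0 (z - x)" by (simp add: diff_inf_eq_sup add_sup_distrib_left)
    then have 1: "0 \<le> z - inf z x" "z - inf z x \<le> y"
      using z assms by (simp_all add: algebra_simps)
    have "f z = f (inf z x) + f (z - inf z x)"
      by (simp only: blinfun.diff_right) simp
    also have "\<dots> \<le> rk f x + rk f y"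
      using 1 z assms by (intro add_mono rk_upper) auto
    finally show "f z \<le> rk f x + rk f y" .
  qed (use assms in simp)
next
  have sum_le: "f b \<le> rk f (x + y) - f a" if "0 \<le> a" "a \<le> x" "0 \<le> b" "b \<le> y" for a b
  proof -
    have "f (b + a) \<le> rk f (x + y)"
      using that add_mono[OF that(2,4)] by (intro rk_upper) (auto simp: add.commute)
    then show ?thesis by (simp only: le_diff_eq blinfun.add_right)
  qed
  have "rk f y \<le> rk f (x + y) - f a" if "0 \<le> a" "a \<le> x" for a
    using that assms by (intro rk_least) (auto intro: sum_le)
  then have "rk f x \<le> rk f (x + y) - rk f y"
    using assms by (intro rk_least) (auto simp: algebra_simps)
  then show "rk f x + rk f y \<le> rk f (x + y)" by (simp add: algebra_simps)
qed

lemma rk_scaleR: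
  assumes "0 \<le> x" "0 \<le> c"
  shows "rk f (c *\<^sub>R x) = c *\<^sub>R rk f x"
proof (cases "c = 0")
  case True
  then show ?thesis by (simp add: rk_def)
next
  case False
  have le: "rk f (d *\<^sub>R y) \<le> d *\<^sub>R rk f y" if d: "d > 0" and y: "0 \<le> y" for d y
  proof (rule rk_least)
    show "0 \<le> d *\<^sub>R y" using d y by (simp add: scaleR_nonneg_nonneg)
    fix z assume z: "0 \<le> z" "z \<le> d *\<^sub>R y"
    have "inverse d *\<^sub>R z \<le> inverse d *\<^sub>R (d *\<^sub>R y)"
      using z d by (intro scaleR_left_mono) auto
    then have "f (inverse d *\<^sub>R z) \<le> rk f y"
      using d z by (intro rk_upper scaleR_nonneg_nonneg) auto
    then have "d *\<^sub>R f (inverse d *\<^sub>R z) \<le> d *\<^sub>R rk f y"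
      using d by (intro scaleR_left_mono) auto
    then show "f z \<le> d *\<^sub>R rk f y" using d by (simp add: blinfun.scaleR_right)
  qed
  have c: "c > 0" using False assms by simp
  have "rk f (inverse c *\<^sub>R (c *\<^sub>R x)) \<le> inverse c *\<^sub>R rk f (c *\<^sub>R x)"
    using c assms by (intro le scaleR_nonneg_nonneg) auto
  then have "c *\<^sub>R rk f x \<le> c *\<^sub>R (inverse c *\<^sub>R rk f (c *\<^sub>R x))"
    using c by (intro scaleR_left_mono) auto
  then have "c *\<^sub>R rk f x \<le> rk f (c *\<^sub>R x)" using c by simp
  then show ?thesis using le[OF c assms(1)] by (intro antisym)
qed

lemma rk_diff_eq:
  assumes "0 \<le> a" "0 \<le> b" "x = a - b"
  shows "rk f (pprt x) - rk f (pprt (- x)) = rk f a - rk f b"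
proof -
  have "pprt x + b = pprt (- x) + a"
  proof -
    have "pprt x = x + pprt (- x)" using pprt_diff[of x] by (simp only: diff_eq_eq)
    moreover have "x + b = a" using assms(3) by simp
    ultimately show ?thesis by (metis add.assoc add.commute)
  qed
  then have "rk f (pprt x + b) = rk f (pprt (- x) + a)" by simp
  then have "rk f (pprt x) + rk f b = rk f (pprt (- x)) + rk f a"
    using assms(1,2) by (simp only: rk_add zero_le_pprt)
  then have "rk f (pprt x) = rk f (pprt (- x)) + rk f a - rk f b"
    by (simp only: eq_diff_eq)
  then show ?thesis by simp
qed

lift_definition blinfun_pos :: "('a::banach_lattice \<Rightarrow>\<^sub>L 'b::unital_banach_lattice) \<Rightarrow> 'a \<Rightarrow>\<^sub>L 'b"
  is "\<lambda>f x. (SUP z\<in>{0..pprt x}. f z) - (SUP z\<in>{0..pprt (- x)}. f z)"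
proof -
  fix f' :: "'a \<Rightarrow> 'b" assume "bounded_linear f'"
  then obtain f where f: "f' = blinfun_apply f"
    by (metis bounded_linear_Blinfun_apply)
  have "bounded_linear (\<lambda>x. rk f (pprt x) - rk f (pprt (- x)))"
  proof (rule bounded_linear_intro[where K="2 * norm f"])
    fix x y :: 'a and c :: real
    have "rk f (pprt (x + y)) - rk f (pprt (- (x + y)))
      = rk f (pprt x + pprt y) - rk f (pprt (- x) + pprt (- y))"
    proof (rule rk_diff_eq)
      have "x + y = (pprt x - pprt (- x)) + (pprt y - pprt (- y))" by (simp only: pprt_diff)
      then show "x + y = pprt x + pprt y - (pprt (- x) + pprt (- y))"
        by (simp only: add_diff_add)
    qed simp_all
    then show "rk f (pprt (x + y)) - rk f (pprt (- (x + y)))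
      = rk f (pprt x) - rk f (pprt (- x)) + (rk f (pprt y) - rk f (pprt (- y)))"
      by (simp add: rk_add)
    show "rk f (pprt (c *\<^sub>R x)) - rk f (pprt (- (c *\<^sub>R x))) =
      c *\<^sub>R (rk f (pprt x) - rk f (pprt (- x)))"
    proof (cases "0 \<le> c")
      case True
      then have "rk f (pprt (c *\<^sub>R x)) - rk f (pprt (- (c *\<^sub>R x)))
        = rk f (c *\<^sub>R pprt x) - rk f (c *\<^sub>R pprt (- x))"
        by (intro rk_diff_eq)
          (simp_all add: scaleR_nonneg_nonneg pprt_diff flip: scaleR_diff_right)
      then show ?thesis using True by (simp add: rk_scaleR scaleR_diff_right)
    next
      case False
      then have "rk f (pprt (c *\<^sub>R x)) - rk f (pprt (- (c *\<^sub>R x)))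
        = rk f ((- c) *\<^sub>R pprt (- x)) - rk f ((- c) *\<^sub>R pprt x)"
      proof (intro rk_diff_eq)
        have "c *\<^sub>R x = c *\<^sub>R (pprt x - pprt (- x))" by (simp only: pprt_diff)
        then show "c *\<^sub>R x = (- c) *\<^sub>R pprt (- x) - (- c) *\<^sub>R pprt x"
          by (simp only: scaleR_diff_right scaleR_minus_left) simp
      next
        have c: "0 \<le> - c" using False by simp
        show "0 \<le> (- c) *\<^sub>R pprt (- x)" "0 \<le> (- c) *\<^sub>R pprt x"
          by (simp_all only: scaleR_nonneg_nonneg c zero_le_pprt)
      qed
      also have "\<dots> = (- c) *\<^sub>R rk f (pprt (- x)) - (- c) *\<^sub>R rk f (pprt x)"
        using False by (subst (1 2) rk_scaleR) simp_all
      finally show ?thesis by (simp add: algebra_simps)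
    qed
    have "norm (rk f (pprt x)) \<le> norm f * norm x" "norm (rk f (pprt (- x))) \<le> norm f * norm x"
      using rk_norm[of "pprt x" f] mult_left_mono[OF norm_pprt_le[of x] norm_ge_zero[of f]]
        rk_norm[of "pprt (- x)" f] mult_left_mono[OF norm_pprt_le[of "- x"] norm_ge_zero[of f]]
      by simp_all
    then show "norm (rk f (pprt x) - rk f (pprt (- x))) \<le> norm x * (2 * norm f)"
      using norm_triangle_ineq4[of "rk f (pprt x)" "rk f (pprt (- x))"] by (simp add: mult.commute)
  qed
  then show "bounded_linear (\<lambda>x. (SUP z\<in>{0..pprt x}. f' z) - (SUP z\<in>{0..pprt (- x)}. f' z))"
    by (simp add: rk_def f)
qed

lemma blinfun_pos_apply: "0 \<le> x \<Longrightarrow> blinfun_pos f x = rk f x"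
  by (simp add: blinfun_pos.rep_eq rk_def)

instantiation blinfun :: (banach_lattice, unital_banach_lattice) banach_lattice
begin

definition less_eq_blinfun :: "('a \<Rightarrow>\<^sub>L 'b) \<Rightarrow> ('a \<Rightarrow>\<^sub>L 'b) \<Rightarrow> bool"
  where "f \<le> g \<longleftrightarrow> (\<forall>x\<ge>0. blinfun_apply f x \<le> blinfun_apply g x)"

definition less_blinfun :: "('a \<Rightarrow>\<^sub>L 'b) \<Rightarrow> ('a \<Rightarrow>\<^sub>L 'b) \<Rightarrow> bool"
  where "f < g \<longleftrightarrow> f \<le> g \<and> \<not> g \<le> (f :: 'a \<Rightarrow>\<^sub>L 'b)"

definition sup_blinfun :: "('a \<Rightarrow>\<^sub>L 'b) \<Rightarrow> ('a \<Rightarrow>\<^sub>L 'b) \<Rightarrow> 'a \<Rightarrow>\<^sub>L 'b"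
  where "sup f g = g + blinfun_pos (f - g)"

definition inf_blinfun :: "('a \<Rightarrow>\<^sub>L 'b) \<Rightarrow> ('a \<Rightarrow>\<^sub>L 'b) \<Rightarrow> 'a \<Rightarrow>\<^sub>L 'b"
  where "inf f g = - sup (- f) (- g :: 'a \<Rightarrow>\<^sub>L 'b)"

definition abs_blinfun :: "('a \<Rightarrow>\<^sub>L 'b) \<Rightarrow> 'a \<Rightarrow>\<^sub>L 'b"
  where "\<bar>f\<bar> = sup f (- f :: 'a \<Rightarrow>\<^sub>L 'b)"

instance
proof
  fix f g h :: "'a \<Rightarrow>\<^sub>L 'b" and a b :: real
  have sup1: "f \<le> sup f g" for f g :: "'a \<Rightarrow>\<^sub>L 'b"
    unfolding less_eq_blinfun_def sup_blinfun_def
  proof (intro allI impI)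
    fix x :: 'a assume x: "0 \<le> x"
    have "(f - g) x \<le> rk (f - g) x" using x by (intro rk_upper) auto
    then show "f x \<le> (g + blinfun_pos (f - g)) x"
      using x by (simp add: blinfun.add_left blinfun.diff_left blinfun_pos_apply algebra_simps)
  qed
  have sup2: "g \<le> sup f g" for f g :: "'a \<Rightarrow>\<^sub>L 'b"
    by (simp add: less_eq_blinfun_def sup_blinfun_def blinfun.add_left blinfun_pos_apply rk_nonneg)
  have sup3: "sup f g \<le> h" if "f \<le> h" "g \<le> h" for f g h :: "'a \<Rightarrow>\<^sub>L 'b"
    unfolding less_eq_blinfun_def sup_blinfun_def
  proof (intro allI impI)
    fix x :: 'a assume x: "0 \<le> x"
    have "rk (f - g) x \<le> (h - g) x"
    proof (rule rk_least[OF x])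
      fix z assume z: "0 \<le> z" "z \<le> x"
      have "(f - g) z \<le> (h - g) z"
        using that z by (simp add: less_eq_blinfun_def blinfun.diff_left)
      also have "\<dots> \<le> (h - g) z + (h - g) (x - z)"
        using that(2) z by (simp add: less_eq_blinfun_def blinfun.diff_left)
      also have "\<dots> = (h - g) x" by (simp add: blinfun.diff_right)
      finally show "(f - g) z \<le> (h - g) x" .
    qed
    then show "(g + blinfun_pos (f - g)) x \<le> h x"
      using x by (simp add: blinfun.add_left blinfun.diff_left blinfun_pos_apply algebra_simps)
  qed
  have neg: "f \<le> - g \<longleftrightarrow> g \<le> - f" "- f \<le> g \<longleftrightarrow> - g \<le> f" for f g :: "'a \<Rightarrow>\<^sub>L 'b"
    by (auto simp: less_eq_blinfun_def blinfun.minus_left le_minus_iff minus_le_iff)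
  show "f \<le> sup f g" "g \<le> sup f g" by (rule sup1 sup2)+
  show "g \<le> f \<Longrightarrow> h \<le> f \<Longrightarrow> sup g h \<le> f" by (rule sup3)
  show "inf f g \<le> f" "inf f g \<le> g"
    using sup1[of "- f" "- g"] sup2[of "- g" "- f"] by (simp_all add: inf_blinfun_def neg(2))
  show "f \<le> g \<Longrightarrow> f \<le> h \<Longrightarrow> f \<le> inf g h"
    unfolding inf_blinfun_def
    by (subst neg(1), rule sup3) (simp_all add: less_eq_blinfun_def blinfun.minus_left)
  show "(f < g) = (f \<le> g \<and> \<not> g \<le> f)" by (rule less_blinfun_def)
  show "f \<le> f" by (simp add: less_eq_blinfun_def)
  show "f \<le> g \<Longrightarrow> g \<le> h \<Longrightarrow> f \<le> h" unfolding less_eq_blinfun_def by (meson order_trans)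
  show "f = g" if "f \<le> g" "g \<le> f"
  proof (rule blinfun_eqI)
    fix x
    have *: "f x = g x" if "0 \<le> x" for x
      using \<open>f \<le> g\<close> \<open>g \<le> f\<close> that by (intro antisym) (auto simp: less_eq_blinfun_def)
    have "f (pprt x - pprt (- x)) = g (pprt x - pprt (- x))"
      by (simp add: blinfun.diff_right *)
    then show "f x = g x" by (simp add: pprt_diff)
  qed
  show "f \<le> g \<Longrightarrow> h + f \<le> h + g" by (simp add: less_eq_blinfun_def blinfun.add_left)
  show "f \<le> g \<Longrightarrow> 0 \<le> a \<Longrightarrow> a *\<^sub>R f \<le> a *\<^sub>R g"
    by (simp add: less_eq_blinfun_def blinfun.scaleR_left scaleR_left_mono)
  show "a \<le> b \<Longrightarrow> 0 \<le> f \<Longrightarrow> a *\<^sub>R f \<le> b *\<^sub>R f"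
    by (simp add: less_eq_blinfun_def blinfun.scaleR_left scaleR_right_mono)
  show "\<bar>f\<bar> = sup f (- f)" by (rule abs_blinfun_def)
  have abs_bound: "\<bar>g\<bar> x \<le> (norm g * norm x) *\<^sub>R order_unit" if x: "0 \<le> x" for x
  proof -
    have "rk (g - - g) x \<le> (norm g * norm x) *\<^sub>R order_unit + g x"
    proof (rule rk_least[OF x])
      fix z assume z: "0 \<le> z" "z \<le> x"
      have "z + z - x \<le> x" "- (z + z - x) \<le> x"
        using add_mono[OF z(2) z(2)] add_nonneg_nonneg[OF z(1) z(1)]
        by (simp_all add: algebra_simps)
      then have "\<bar>z + z - x\<bar> \<le> \<bar>x\<bar>" using x by (simp add: abs_le_iff)
      then have "norm (z + z - x) \<le> norm x" by (rule norm_mono_abs)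
      then have "norm (g (z + z - x)) \<le> norm g * norm x"
        using norm_blinfun[of g "z + z - x"] mult_left_mono[OF _ norm_ge_zero[of g]]
        by (meson order_trans)
      then have "g (z + z - x) \<le> (norm g * norm x) *\<^sub>R order_unit" by (rule le_unit)
      then show "(g - - g) z \<le> (norm g * norm x) *\<^sub>R order_unit + g x"
        by (simp add: blinfun.bilinear_simps algebra_simps)
    qed
    then have "rk (g - - g) x - g x \<le> (norm g * norm x) *\<^sub>R order_unit"
      by (simp only: diff_le_eq)
    moreover have "\<bar>g\<bar> x = rk (g - - g) x - g x"
      unfolding abs_blinfun_def sup_blinfun_def blinfun.add_left blinfun.minus_left
        blinfun_pos_apply[OF x] by simp
    ultimately show ?thesis by simp
  qed
  have abs_apply: "\<bar>f x\<bar> \<le> \<bar>f\<bar> \<bar>x\<bar>" for x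
  proof -
    have pos: "f y \<le> \<bar>f\<bar> y" "- f y \<le> \<bar>f\<bar> y" if "0 \<le> y" for y
      using sup1[of f "- f"] sup2[of "- f" f] that
      by (simp_all add: less_eq_blinfun_def abs_blinfun_def blinfun.minus_left)
    have fx: "f x = f (pprt x) - f (pprt (- x))"
      by (simp add: pprt_diff flip: blinfun.diff_right)
    have ax: "\<bar>f\<bar> \<bar>x\<bar> = \<bar>f\<bar> (pprt x) + \<bar>f\<bar> (pprt (- x))"
      by (simp add: pprt_add flip: blinfun.add_right)
    show ?thesis
      using add_mono[OF pos(1)[of "pprt x"] pos(2)[of "pprt (- x)"]]
        add_mono[OF pos(2)[of "pprt x"] pos(1)[of "pprt (- x)"]]
      by (intro abs_leI) (simp_all add: fx ax)
  qed
  show "norm f \<le> norm g" if "\<bar>f\<bar> \<le> \<bar>g\<bar>"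
  proof (rule norm_blinfun_bound)
    fix x
    have "\<bar>f x\<bar> \<le> \<bar>f\<bar> \<bar>x\<bar>" by (rule abs_apply)
    also have "\<dots> \<le> \<bar>g\<bar> \<bar>x\<bar>" using that by (simp add: less_eq_blinfun_def)
    also have "\<dots> \<le> (norm g * norm \<bar>x\<bar>) *\<^sub>R order_unit" by (rule abs_bound) simp
    finally show "norm (f x) \<le> norm g * norm x"
      by (intro norm_le_if_abs_le_unit) (simp_all add: norm_abs_eq)
  qed simp
qed

end

lift_definition dual_adjoint ::
  "('a::real_normed_vector \<Rightarrow>\<^sub>L 'b::real_normed_vector) \<Rightarrow> ('b \<Rightarrow>\<^sub>L real) \<Rightarrow>\<^sub>L ('a \<Rightarrow>\<^sub>L real)"
  is "\<lambda>T f. f o\<^sub>L T"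
  by (rule bounded_bilinear.bounded_linear_left[OF bounded_bilinear_blinfun_compose])

section \<open>L-weak and M-weak compactness\<close>

definition disjoint_seq :: "(nat \<Rightarrow> 'a::banach_lattice) \<Rightarrow> bool"
  where "disjoint_seq x \<longleftrightarrow> (\<forall>m n. m \<noteq> n \<longrightarrow> inf \<bar>x m\<bar> \<bar>x n\<bar> = 0)"

definition solid_hull :: "'a::banach_lattice set \<Rightarrow> 'a set"
  where "solid_hull A = {x. \<exists>a\<in>A. \<bar>x\<bar> \<le> \<bar>a\<bar>}"

definition L_weakly_compact :: "'a::banach_lattice set \<Rightarrow> bool"
  where "L_weakly_compact A \<longleftrightarrow> A \<noteq> {} \<and> bounded A \<and>
    (\<forall>x. disjoint_seq x \<and> range x \<subseteq> solid_hull A \<longrightarrow> (\<lambda>n. norm (x n)) \<longlonglongrightarrow> 0)"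

definition order_L_weakly_compact :: "('a::banach_lattice \<Rightarrow>\<^sub>L 'b::banach_lattice) \<Rightarrow> bool"
  where "order_L_weakly_compact T \<longleftrightarrow> (\<forall>x\<ge>0. L_weakly_compact (blinfun_apply T ` {0..x}))"

definition order_bounded :: "'a::banach_lattice set \<Rightarrow> bool"
  where "order_bounded A \<longleftrightarrow> (\<exists>a b. A \<subseteq> {a..b})"

definition order_M_weakly_compact :: "('a::banach_lattice \<Rightarrow>\<^sub>L 'b::banach_lattice) \<Rightarrow> bool"
  where "order_M_weakly_compact T \<longleftrightarrow>
    (\<forall>(x :: nat \<Rightarrow> 'a) (f :: nat \<Rightarrow> 'b \<Rightarrow>\<^sub>L real).
      disjoint_seq x \<and> range x \<subseteq> cball 0 1 \<and> order_bounded (range f) \<longrightarrow>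
      (\<lambda>n. blinfun_apply (f n) (blinfun_apply T (x n))) \<longlonglongrightarrow> 0)"

end

theory Submission
  imports Defs
begin

text \<open>
  Both parts rest on a duality: a bounded set \<open>A\<close> in one of the spaces \<open>G\<close>, \<open>G'\<close> is
  L-weakly compact iff disjoint sequences in the unit ball of the other space tend to zero
  uniformly on \<open>A\<close>. With \<open>A = T'[0, h]\<close> this is part (1), and with \<open>A = T[0, x]\<close>, viewing
  \<open>[0, x]\<close> as an order bounded subset of the bidual, it is part (2).

  Disjoint vectors \<open>x\<^sub>n\<close> are turned into disjoint functionals by restricting functionals to the
  ideals generated by the \<open>x\<^sub>n\<close>; for \<open>A \<subseteq> G\<close> one starts from norming functionals, given by
  Hahn--Banach (a minimal sublinear functional is linear). The converse, from disjoint functionals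
  \<open>f\<^sub>n\<close> to disjoint vectors, is a disjointification along a subsequence, driven by the
  Riesz--Kantorovich formula and the pigeonhole principle.
\<close>


section \<open>Disjointness in Banach lattices\<close>

text \<open>Translating by \<open>pprt (- x)\<close> turns the infimum of \<open>x\<close> and
  \<open>0\<close>, the negative part, into the infimum of the two parts.\<close>

lemma inf_pprt_pprt_uminus: "inf (pprt x) (pprt (- x)) = (0::'a::banach_lattice)"
proof -
  have "inf (pprt x) (pprt (- x)) = inf (x + pprt (- x)) (0 + pprt (- x))"
    using pprt_diff[of x] by (metis add.commute add_0 diff_eq_eq)
  also have "\<dots> = nprt x + pprt (- x)"
    by (simp only: nprt_def add_inf_distrib_right)
  finally show ?thesis by (simp add: pprt_neg)
qed

lemma disjoint_mono:
  fixes x y :: "'a::banach_lattice"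
  assumes "inf x y = 0" "0 \<le> u" "u \<le> x" "0 \<le> v" "v \<le> y"
  shows "inf u v = 0"
  using inf_mono[OF assms(3,5)] assms by (intro antisym) auto

lemma inf_scaleR:
  fixes x y :: "'a::banach_lattice"
  assumes "0 < c"
  shows "inf (c *\<^sub>R x) (c *\<^sub>R y) = c *\<^sub>R inf x y"
proof (rule antisym)
  have "inverse c *\<^sub>R inf (c *\<^sub>R x) (c *\<^sub>R y) \<le> inf x y"
    using scaleR_left_mono[of "inf (c *\<^sub>R x) (c *\<^sub>R y)" "c *\<^sub>R x" "inverse c"]
      scaleR_left_mono[of "inf (c *\<^sub>R x) (c *\<^sub>R y)" "c *\<^sub>R y" "inverse c"] assms
    by (intro inf_greatest) auto
  then have "c *\<^sub>R inverse c *\<^sub>R inf (c *\<^sub>R x) (c *\<^sub>R y) \<le> c *\<^sub>R inf x y"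
    using assms by (intro scaleR_left_mono) auto
  then show "inf (c *\<^sub>R x) (c *\<^sub>R y) \<le> c *\<^sub>R inf x y" using assms by simp
  show "c *\<^sub>R inf x y \<le> inf (c *\<^sub>R x) (c *\<^sub>R y)"
    using assms by (intro inf_greatest scaleR_left_mono) auto
qed

lemma scaleR_mono_left_nonneg:
  fixes x :: "'a::banach_lattice"
  assumes "0 \<le> x" "a \<le> b"
  shows "a *\<^sub>R x \<le> b *\<^sub>R x"
  using assms by (intro scaleR_right_mono) auto

lemma disjoint_scaleR:
  fixes x y :: "'a::banach_lattice"
  assumes "inf x y = 0" "0 \<le> a" "0 \<le> b"
  shows "inf (a *\<^sub>R x) (b *\<^sub>R y) = 0"
proof -
  \<comment> \<open>A common positive multiple dominating both scalars: \<open>inf_scaleR\<close>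
    handles equal factors, and \<open>disjoint_mono\<close> then shrinks them.\<close>
  define c where "c = max 1 (max a b)"
  have xy: "0 \<le> x" "0 \<le> y"
    by (simp_all add: assms(1)[symmetric])
  have "inf (c *\<^sub>R x) (c *\<^sub>R y) = 0"
    using assms(1) by (subst inf_scaleR) (auto simp: c_def)
  then show ?thesis
    by (rule disjoint_mono)
      (use xy assms in \<open>auto simp: c_def intro!: scaleR_nonneg_nonneg scaleR_mono_left_nonneg\<close>)
qed

text \<open>By distributivity the right side is the infimum of the four sums \<open>x + x\<close>,
  \<open>x + b\<close>, \<open>a + x\<close> and \<open>a + b\<close>, each of which lies above the
  left side.\<close>

lemma inf_add_le:
  fixes x a b :: "'a::banach_lattice"
  assumes "0 \<le> a" "0 \<le> b" "0 \<le> x"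
  shows "inf x (a + b) \<le> inf x a + inf x b"
proof -
  have "inf x (a + b) \<le> x + b" "inf x (a + b) \<le> x + x" "inf x (a + b) \<le> a + x"
    using assms by (auto intro: add_increasing2 le_infI1 add_increasing)
  then show ?thesis
    unfolding add_inf_distrib_left add_inf_distrib_right
    by (intro inf_greatest) (auto intro: le_infI2 le_infI1)
qed

lemma sum_inf_disjoint:
  fixes V :: "'i \<Rightarrow> 'a::banach_lattice"
  assumes "finite I" "0 \<le> x" "\<And>i. i \<in> I \<Longrightarrow> 0 \<le> V i"
    and "\<And>i j. i \<in> I \<Longrightarrow> j \<in> I \<Longrightarrow> i \<noteq> j \<Longrightarrow> inf (V i) (V j) = 0"
  shows "(\<Sum>i\<in>I. inf x (V i)) \<le> x"
proof -
  \<comment> \<open>The induction also carries that whatever is disjoint from all \<open>V i\<close>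
    is disjoint from the partial sum; this is applied to the next \<open>V j\<close>.\<close>
  have "(\<Sum>i\<in>I. inf x (V i)) \<le> x \<and>
    (\<forall>v\<ge>0. (\<forall>i\<in>I. inf v (V i) = 0) \<longrightarrow> inf v (\<Sum>i\<in>I. inf x (V i)) = 0)"
    using assms
  proof (induction I rule: finite_induct)
    case (insert j I)
    let ?s = "\<Sum>i\<in>I. inf x (V i)"
    have IH: "?s \<le> x" "\<And>v. 0 \<le> v \<Longrightarrow> (\<forall>i\<in>I. inf v (V i) = 0) \<Longrightarrow> inf v ?s = 0"
      using insert by auto
    have s: "0 \<le> ?s" using insert by (intro sum_nonneg) auto
    have "inf (V j) ?s = 0"
      using insert by (intro IH(2)) auto
    then have "inf (inf x (V j)) ?s = 0"
      by (rule disjoint_mono) (use insert s in auto)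
    \<comment> \<open>The sum of two disjoint elements is their supremum, and \<open>x\<close>
      bounds both.\<close>
    then have "inf x (V j) + ?s \<le> x"
      using IH(1) add_eq_inf_sup[of "inf x (V j)" ?s] by simp
    moreover have "inf v (inf x (V j) + ?s) = 0"
      if v: "0 \<le> v" "\<forall>i\<in>insert j I. inf v (V i) = 0" for v
    proof (rule antisym)
      have "inf v (inf x (V j)) = 0"
        by (rule disjoint_mono[of v "V j"]) (use v insert in auto)
      then show "inf v (inf x (V j) + ?s) \<le> 0"
        using inf_add_le[of "inf x (V j)" ?s v] v insert s IH(2)[of v] by simp
      show "0 \<le> inf v (inf x (V j) + ?s)"
        using v insert s by auto
    qed
    ultimately show ?case using insert by simp
  qed (simp add: inf_absorb2)
  then show ?thesis by blast
qed

section \<open>Closedness of the positive cone and order bounds for sequences\<close>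

lemma norm_pprt_uminus_le:
  fixes x y :: "'a::banach_lattice"
  assumes "0 \<le> y"
  shows "norm (pprt (- x)) \<le> norm (x - y)"
proof -
  have "- x \<le> y - x" using assms by simp
  also have "\<dots> \<le> \<bar>x - y\<bar>" using abs_ge_minus_self[of "x - y"] by simp
  finally have "pprt (- x) \<le> \<bar>x - y\<bar>" by (simp add: pprt_def)
  then have "norm (pprt (- x)) \<le> norm \<bar>x - y\<bar>"
    by (intro norm_mono_nonneg) auto
  then show ?thesis by (simp add: norm_abs_eq)
qed

lemma nonneg_LIMSEQ:
  fixes X :: "nat \<Rightarrow> 'a::banach_lattice"
  assumes "X \<longlonglongrightarrow> x" "\<forall>\<^sub>F n in sequentially. 0 \<le> X n"
  shows "0 \<le> x"
proof -
  have "(\<lambda>n. norm (x - X n)) \<longlonglongrightarrow> norm (x - x)"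
    by (intro tendsto_intros assms)
  moreover have "\<forall>\<^sub>F n in sequentially. norm (pprt (- x)) \<le> norm (x - X n)"
    using assms(2) by eventually_elim (rule norm_pprt_uminus_le)
  ultimately have "norm (pprt (- x)) \<le> norm (x - x)"
    by (intro tendsto_lowerbound) auto
  then show ?thesis by (simp add: flip: le_zero_iff_zero_pprt)
qed

text \<open>The bound \<open>e\<close> is the sum of the absolutely convergent series of the vectors
  \<open>x n\<close> scaled by \<open>1 / 2 ^ Suc n\<close>. Since the cone is closed, the sum of
  nonnegative terms dominates each term.\<close>

lemma common_bound:
  fixes x :: "nat \<Rightarrow> 'a::banach_lattice"
  assumes "\<And>n. 0 \<le> x n" "\<And>n. norm (x n) \<le> 1"
  obtains e where "0 \<le> e" "\<And>n. x n \<le> 2 ^ Suc n *\<^sub>R e"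
proof -
  define t where "t n = (1 / 2 ^ Suc n :: real) *\<^sub>R x n" for n
  have t: "0 \<le> t n" for n
    using assms(1) by (simp add: t_def scaleR_nonneg_nonneg)
  have "summable t"
  proof (rule summable_comparison_test')
    show "summable (\<lambda>n. (1 / 2 :: real) ^ n)" by (rule summable_geometric) simp
    show "norm (t n) \<le> (1 / 2) ^ n" for n
      using assms(2)[of n] by (simp add: t_def field_simps power_divide)
  qed
  then have lim: "(\<lambda>n. sum t {..<n}) \<longlonglongrightarrow> suminf t"
    by (rule summable_LIMSEQ)
  have ge: "t m \<le> suminf t" for m
  proof -
    have "(\<lambda>n. sum t {..<n} - t m) \<longlonglongrightarrow> suminf t - t m"
      by (intro tendsto_intros lim)
    moreover have "\<forall>\<^sub>F n in sequentially. 0 \<le> sum t {..<n} - t m"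
      using eventually_gt_at_top[of m]
    proof eventually_elim
      case (elim n)
      then have "sum t {m} \<le> sum t {..<n}"
        using t by (intro sum_mono2) auto
      then show ?case by simp
    qed
    ultimately have "0 \<le> suminf t - t m" by (rule nonneg_LIMSEQ)
    then show ?thesis by simp
  qed
  show ?thesis
  proof
    show "0 \<le> suminf t" using t[of 0] ge[of 0] by (rule order_trans)
    fix n
    have "(2 ^ Suc n :: real) *\<^sub>R t n \<le> 2 ^ Suc n *\<^sub>R suminf t"
      by (intro scaleR_left_mono ge) simp
    then show "x n \<le> 2 ^ Suc n *\<^sub>R suminf t" by (simp add: t_def)
  qed
qed

section \<open>Disjoint sequences and a criterion for L-weak compactness\<close>

lemma disjoint_seq_subseq: "disjoint_seq x \<Longrightarrow> inj r \<Longrightarrow> disjoint_seq (x \<circ> r)"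
  by (simp add: disjoint_seq_def inj_eq)

lemma disjoint_seq_abs_mono:
  assumes "disjoint_seq x" "\<And>n. \<bar>y n\<bar> \<le> \<bar>x n\<bar>"
  shows "disjoint_seq y"
  unfolding disjoint_seq_def
proof (intro allI impI)
  fix m n :: nat assume "m \<noteq> n"
  then have "inf \<bar>x m\<bar> \<bar>x n\<bar> = 0" using assms(1) by (simp add: disjoint_seq_def)
  then show "inf \<bar>y m\<bar> \<bar>y n\<bar> = 0"
    by (rule disjoint_mono) (use assms(2) in auto)
qed

text \<open>If the norms do not tend to zero, a subsequence stays above some
  \<open>\<epsilon>\<close>, and it is again disjoint and in the solid hull. Hence only sequences
  bounded away from zero have to be refuted.\<close>

lemma L_weakly_compactI:
  fixes A :: "'a::banach_lattice set"
  assumes "A \<noteq> {}" "bounded A"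
    and "\<And>x \<epsilon>. disjoint_seq x \<Longrightarrow> range x \<subseteq> solid_hull A \<Longrightarrow> 0 < \<epsilon> \<Longrightarrow> (\<And>n. \<epsilon> \<le> norm (x n)) \<Longrightarrow> False"
  shows "L_weakly_compact A"
  unfolding L_weakly_compact_def
proof (intro conjI assms(1,2) allI impI)
  fix x assume x: "disjoint_seq x \<and> range x \<subseteq> solid_hull A"
  show "(\<lambda>n. norm (x n)) \<longlonglongrightarrow> 0"
  proof (rule ccontr)
    assume "\<not> (\<lambda>n. norm (x n)) \<longlonglongrightarrow> 0"
    then obtain \<epsilon> where \<epsilon>: "0 < \<epsilon>" and "\<not> (\<forall>\<^sub>F n in sequentially. norm (x n) < \<epsilon>)"
      by (auto simp: tendsto_iff dist_real_def)
    then have inf: "infinite {n. \<epsilon> \<le> norm (x n)}"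
      by (simp add: eventually_sequentially infinite_nat_iff_unbounded_le not_less)
    define r where "r = enumerate {n. \<epsilon> \<le> norm (x n)}"
    have "inj r"
      unfolding r_def using strict_mono_enumerate[OF inf] by (rule strict_mono_imp_inj_on)
    moreover have "\<epsilon> \<le> norm ((x \<circ> r) n)" for n
      using enumerate_in_set[OF inf, of n] by (simp add: r_def)
    moreover have "range (x \<circ> r) \<subseteq> solid_hull A" using x by auto
    ultimately show False using assms(3)[of "x \<circ> r" \<epsilon>] x \<epsilon> disjoint_seq_subseq by blast
  qed
qed

section \<open>The lattice operations of the dual\<close>

lemma dual_nonneg_iff: "0 \<le> f \<longleftrightarrow> (\<forall>x\<ge>0. 0 \<le> blinfun_apply f x)"
  for f :: "'a::banach_lattice \<Rightarrow>\<^sub>L real"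
  by (simp add: less_eq_blinfun_def)

lemma dual_le_apply: "f \<le> g \<Longrightarrow> 0 \<le> x \<Longrightarrow> blinfun_apply f x \<le> blinfun_apply g x"
  for f :: "'a::banach_lattice \<Rightarrow>\<^sub>L real"
  by (simp add: less_eq_blinfun_def)

lemma dual_apply_nonneg: "0 \<le> f \<Longrightarrow> 0 \<le> x \<Longrightarrow> 0 \<le> blinfun_apply f x"
  for f :: "'a::banach_lattice \<Rightarrow>\<^sub>L real"
  by (simp add: dual_nonneg_iff)

lemma dual_apply_mono: "0 \<le> f \<Longrightarrow> x \<le> y \<Longrightarrow> blinfun_apply f x \<le> blinfun_apply f y"
  for f :: "'a::banach_lattice \<Rightarrow>\<^sub>L real"
  using dual_apply_nonneg[of f "y - x"] by (simp add: blinfun.diff_right)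

lemma dual_abs_apply_le: "\<bar>blinfun_apply f x\<bar> \<le> blinfun_apply \<bar>f\<bar> \<bar>x\<bar>"
  for f :: "'a::banach_lattice \<Rightarrow>\<^sub>L real"
proof -
  have pos: "\<bar>f y\<bar> \<le> \<bar>f\<bar> y" if "0 \<le> y" for y
    using dual_le_apply[OF abs_ge_self that, of f] dual_le_apply[OF abs_ge_minus_self that, of f]
    by (simp add: blinfun.minus_left abs_le_iff)
  have "f x = f (pprt x) - f (pprt (- x))"
    by (simp add: pprt_diff flip: blinfun.diff_right)
  moreover have "\<bar>f\<bar> \<bar>x\<bar> = \<bar>f\<bar> (pprt x) + \<bar>f\<bar> (pprt (- x))"
    by (simp add: pprt_add flip: blinfun.add_right)
  ultimately show ?thesis
    using pos[of "pprt x"] pos[of "pprt (- x)"] by (simp add: abs_le_iff)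
qed

lemma rk_approx:
  fixes f :: "'a::banach_lattice \<Rightarrow>\<^sub>L real"
  assumes "0 \<le> x" "0 < \<delta>"
  obtains z where "0 \<le> z" "z \<le> x" "rk f x - \<delta> < f z"
proof -
  have "\<not> rk f x \<le> rk f x - \<delta>" using assms by simp
  then show ?thesis
    using rk_least[OF assms(1), of f "rk f x - \<delta>"] that by (meson not_le)
qed

text \<open>The modulus is \<open>- f\<close> plus the positive part of \<open>2 f\<close>, so a
  near-maximizer \<open>z\<close> of \<open>f\<close> on \<open>[0, x]\<close> yields
  \<open>u = 2 z - x\<close> in \<open>[- x, x]\<close>.\<close>

lemma dual_abs_approx:
  fixes f :: "'a::banach_lattice \<Rightarrow>\<^sub>L real"
  assumes "0 \<le> x" "0 < \<delta>"
  obtains u where "\<bar>u\<bar> \<le> x" "\<bar>f\<bar> x - \<delta> < f u"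
proof -
  obtain z where z: "0 \<le> z" "z \<le> x" "rk (f - - f) x - \<delta> < (f - - f) z"
    by (rule rk_approx[OF assms])
  have "\<bar>f\<bar> x = - f x + rk (f - - f) x"
    unfolding abs_blinfun_def sup_blinfun_def
    blinfun.add_left blinfun.minus_left
    using assms(1) by (simp only: blinfun_pos_apply)
  then have "\<bar>f\<bar> x - \<delta> < f (z + z - x)"
    using z(3) by (simp add: blinfun.bilinear_simps)
  moreover have "\<bar>z + z - x\<bar> \<le> x"
    using add_mono[OF z(2) z(2)] add_nonneg_nonneg[OF z(1) z(1)]
    by (intro abs_leI) (simp_all add: algebra_simps)
  ultimately show ?thesis using that by blast
qed

text \<open>By the Riesz-Kantorovich formula, \<open>inf f g\<close> at \<open>x\<close> is the
  infimum of \<open>f (x - u) + g u\<close> over \<open>u\<close> in \<open>[0, x]\<close>. Here it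
  is zero, and both summands are nonnegative, so both can be made small at once.\<close>

lemma dual_disjoint_approx:
  fixes f g :: "'a::banach_lattice \<Rightarrow>\<^sub>L real"
  assumes "inf f g = 0" "0 \<le> x" "0 < \<delta>"
  obtains u where "0 \<le> u" "u \<le> x" "f (x - u) < \<delta>" "g u < \<delta>"
proof -
  have fg: "0 \<le> f" "0 \<le> g" by (simp_all add: assms(1)[symmetric])
  have "inf f g x = g x - rk (- f - - g) x"
    using assms(2) unfolding inf_blinfun_def sup_blinfun_def
    by (simp add: blinfun.bilinear_simps blinfun_pos_apply)
  then have *: "rk (- f - - g) x = g x" using assms(1) by simp
  obtain z where z: "0 \<le> z" "z \<le> x" "g x - \<delta> < (- f - - g) z"
    using rk_approx[OF assms(2,3), of "- f - - g"] unfolding * by blast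
  then have "f z + g (x - z) < \<delta>" by (simp add: blinfun.bilinear_simps)
  moreover have "0 \<le> f z" "0 \<le> g (x - z)"
    using z fg by (auto intro!: dual_apply_nonneg)
  ultimately show ?thesis
    using z by (intro that[of "x - z"]) auto
qed

text \<open>Replacing a vector by its modulus keeps the norm and does not decrease the absolute
  value of a positive functional.\<close>

lemma dual_norm_approx:
  fixes f :: "'a::banach_lattice \<Rightarrow>\<^sub>L real"
  assumes "0 \<le> f" "c < norm f" "0 \<le> c"
  obtains x where "0 \<le> x" "norm x \<le> 1" "c < f x"
proof -
  obtain v where v: "\<not> norm (f v) \<le> c * norm v"
    using norm_blinfun_bound[OF assms(3), of f] assms(2) by fastforce
  then have "v \<noteq> 0" by auto
  have "\<bar>f v\<bar> \<le> f \<bar>v\<bar>" using dual_abs_apply_le[of f v] assms(1) by simp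
  with v have "c * norm v < f \<bar>v\<bar>" by simp
  then have "c < f (inverse (norm v) *\<^sub>R \<bar>v\<bar>)"
    using \<open>v \<noteq> 0\<close> by (simp add: blinfun.scaleR_right field_simps)
  then show ?thesis
    using \<open>v \<noteq> 0\<close> by (intro that[of "inverse (norm v) *\<^sub>R \<bar>v\<bar>"])
      (auto simp: norm_abs_eq intro!: scaleR_nonneg_nonneg)
qed

text \<open>Kantorovich's extension from the cone: the values at the positive and the negative part
  are subtracted.\<close>

lemma positive_functional_extend:
  fixes \<phi> :: "'a::banach_lattice \<Rightarrow> real"
  assumes add: "\<And>x y. 0 \<le> x \<Longrightarrow> 0 \<le> y \<Longrightarrow> \<phi> (x + y) = \<phi> x + \<phi> y"
    and scale: "\<And>c x. 0 \<le> x \<Longrightarrow> 0 < c \<Longrightarrow> \<phi> (c *\<^sub>R x) = c * \<phi> x"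
    and nonneg: "\<And>x. 0 \<le> x \<Longrightarrow> 0 \<le> \<phi> x"
    and bound: "\<And>x. 0 \<le> x \<Longrightarrow> \<phi> x \<le> C * norm x"
  obtains f :: "'a \<Rightarrow>\<^sub>L real" where "\<And>x. 0 \<le> x \<Longrightarrow> f x = \<phi> x"
proof -
  define F where "F x = \<phi> (pprt x) - \<phi> (pprt (- x))" for x
  \<comment> \<open>The value does not depend on the decomposition into nonnegative elements.
    Linearity needs this, since adding positive parts need not give the positive part of a
    sum.\<close>
  have F: "F (a - b) = \<phi> a - \<phi> b" if "0 \<le> a" "0 \<le> b" for a b
  proof -
    have "pprt (a - b) + b = pprt (- (a - b)) + a"
      using pprt_diff[of "a - b"] by (simp add: algebra_simps)
    then have "\<phi> (pprt (a - b)) + \<phi> b = \<phi> (pprt (- (a - b))) + \<phi> a"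
      using that by (metis add zero_le_pprt)
    then show ?thesis by (simp add: F_def)
  qed
  have \<phi>0: "\<phi> 0 = 0" using add[of 0 0] by simp
  have F_minus: "F (- x) = - F x" for x by (simp add: F_def)
  have F_scale: "F (c *\<^sub>R x) = c * F x" if "0 < c" for c x
  proof -
    have "c *\<^sub>R x = c *\<^sub>R pprt x - c *\<^sub>R pprt (- x)"
      by (simp add: pprt_diff flip: scaleR_diff_right)
    then have "F (c *\<^sub>R x) = \<phi> (c *\<^sub>R pprt x) - \<phi> (c *\<^sub>R pprt (- x))"
      using that by (simp only:) (intro F scaleR_nonneg_nonneg, auto)
    then show ?thesis using that by (simp add: scale F_def algebra_simps)
  qed
  have "bounded_linear F"
  proof (rule bounded_linear_intro[where K = "2 * \<bar>C\<bar>"])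
    fix x y :: 'a and c :: real
    have "x + y = (pprt x + pprt y) - (pprt (- x) + pprt (- y))"
      using pprt_diff[of x] pprt_diff[of y] by (metis add_diff_add)
    then have "F (x + y) = \<phi> (pprt x + pprt y) - \<phi> (pprt (- x) + pprt (- y))"
      by (simp only:) (intro F, auto)
    then show "F (x + y) = F x + F y" by (simp add: add F_def)
    show "F (c *\<^sub>R x) = c *\<^sub>R F x"
    proof (cases c "0::real" rule: linorder_cases)
      case less
      then have "F (- ((- c) *\<^sub>R x)) = - (- c * F x)"
        unfolding F_minus by (subst F_scale) auto
      then show ?thesis by simp
    qed (use F_scale in \<open>auto simp: F_def \<phi>0\<close>)
    have *: "\<bar>\<phi> (pprt z)\<bar> \<le> \<bar>C\<bar> * norm z" for z
    proof -
      have "C * norm (pprt z) \<le> \<bar>C\<bar> * norm z"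
        by (intro mult_mono norm_pprt_le) auto
      then show ?thesis using nonneg[of "pprt z"] bound[of "pprt z"] by simp
    qed
    show "norm (F x) \<le> norm x * (2 * \<bar>C\<bar>)"
      using abs_triangle_ineq4[of "\<phi> (pprt x)" "\<phi> (pprt (- x))"] *[of x] *[of "- x"]
      by (simp add: F_def mult.commute[of _ "norm x"])
  qed
  then have "blinfun_apply (Blinfun F) x = F x" for x
    by (simp add: bounded_linear_Blinfun_apply)
  moreover have "F x = \<phi> x" if "0 \<le> x" for x
    using F[of x 0] that by (simp add: \<phi>0)
  ultimately show ?thesis using that by metis
qed


section \<open>Norming functionals\<close>

definition sublinear :: "('a::real_vector \<Rightarrow> real) \<Rightarrow> bool"
  where "sublinear p \<longleftrightarrow> (\<forall>x y. p (x + y) \<le> p x + p y) \<and> (\<forall>c>0. \<forall>x. p (c *\<^sub>R x) = c * p x)"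

text \<open>The reverse inequality comes from scaling back by \<open>inverse c\<close>.\<close>

lemma sublinearI:
  assumes "\<And>x y. p (x + y) \<le> p x + p y"
    and "\<And>c x. 0 < c \<Longrightarrow> p (c *\<^sub>R x) \<le> c * p x"
  shows "sublinear p"
proof -
  have "p (c *\<^sub>R x) = c * p x" if "0 < c" for c x
  proof (rule antisym[OF assms(2)[OF that]])
    have "p (inverse c *\<^sub>R c *\<^sub>R x) \<le> inverse c * p (c *\<^sub>R x)"
      using that by (intro assms(2)) simp
    then show "c * p x \<le> p (c *\<^sub>R x)" using that by (simp add: field_simps)
  qed
  then show ?thesis using assms(1) by (simp add: sublinear_def)
qed

lemma sublinear_add: "sublinear p \<Longrightarrow> p (x + y) \<le> p x + p y"
  by (simp add: sublinear_def)

lemma sublinear_0: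
  assumes "sublinear p"
  shows "p 0 = 0"
proof -
  have "p (2 *\<^sub>R 0) = 2 * p 0"
    using assms unfolding sublinear_def by (metis zero_less_numeral)
  then show ?thesis by simp
qed

lemma sublinear_scaleR: "sublinear p \<Longrightarrow> 0 \<le> c \<Longrightarrow> p (c *\<^sub>R x) = c * p x"
  using sublinear_0[of p] by (cases "c = 0") (auto simp: sublinear_def)

lemma sublinear_uminus_le: "sublinear p \<Longrightarrow> - p (- x) \<le> p x"
  using sublinear_add[of p x "- x"] sublinear_0[of p] by simp

text \<open>The infimum of \<open>q (x + t y) - t q y\<close> over \<open>t \<ge> 0\<close> is
  sublinear; \<open>t = 0\<close> puts it below \<open>q\<close>, and \<open>t = 1\<close> at
  \<open>- y\<close> gives the last bound. It serves both to prove minimal sublinear functionals odd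
  and to prescribe a value at one vector.\<close>

lemma sublinear_shift:
  assumes "sublinear q"
  obtains r where "sublinear r" "r \<le> q" "r (- y) \<le> - q y"
proof -
  define a where "a x t = q (x + t *\<^sub>R y) - t * q y" for x t
  define r where "r x = (INF t\<in>{0..}. a x t)" for x
  \<comment> \<open>A lower bound uniform in \<open>t\<close>, so that the infimum is a genuine real
    infimum.\<close>
  have "- q (- x) \<le> a x t" if "0 \<le> t" for x t
    using sublinear_add[OF assms, of "x + t *\<^sub>R y" "- x"] sublinear_scaleR[OF assms that, of y]
    by (simp add: a_def)
  then have "bdd_below (a x ` {0..})" for x
    by (intro bdd_belowI2) auto
  then have lower: "r x \<le> a x t" if "0 \<le> t" for x t
    unfolding r_def using that by (intro cINF_lower) auto
  have greatest: "b \<le> r x" if "\<And>t. 0 \<le> t \<Longrightarrow> b \<le> a x t" for b x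
    unfolding r_def using that by (intro cINF_greatest) auto
  have "sublinear r"
  proof (rule sublinearI)
    fix x x'
    have "r (x + x') \<le> a x s + a x' t" if "0 \<le> s" "0 \<le> t" for s t
    proof -
      have "r (x + x') \<le> a (x + x') (s + t)" using that by (intro lower) simp
      also have "\<dots> \<le> a x s + a x' t"
        using sublinear_add[OF assms, of "x + s *\<^sub>R y" "x' + t *\<^sub>R y"]
        by (simp add: a_def algebra_simps)
      finally show ?thesis .
    qed
    then have "r (x + x') - a x s \<le> r x'" if "0 \<le> s" for s
      using that by (intro greatest) (simp add: algebra_simps)
    then have "r (x + x') - r x' \<le> r x"
      by (intro greatest) (simp add: algebra_simps)
    then show "r (x + x') \<le> r x + r x'" by simp
  next
    fix c :: real and x assume c: "0 < c"
    have "r (c *\<^sub>R x) \<le> c * a x t" if "0 \<le> t" for t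
      using lower[of "c * t" "c *\<^sub>R x"] sublinear_scaleR[OF assms, of c "x + t *\<^sub>R y"] c that
      by (simp add: a_def algebra_simps)
    then have "r (c *\<^sub>R x) / c \<le> r x"
      using c by (intro greatest) (simp add: field_simps)
    then show "r (c *\<^sub>R x) \<le> c * r x" using c by (simp add: field_simps)
  qed
  moreover have "r \<le> q"
    using lower[of 0] by (simp add: a_def le_fun_def)
  moreover have "r (- y) \<le> - q y"
    using lower[of 1 "- y"] sublinear_0[OF assms] by (simp add: a_def)
  ultimately show ?thesis using that by blast
qed

text \<open>Zorn's lemma for the reversed pointwise order: a nonempty chain has its pointwise
  infimum as a bound, and the empty chain has \<open>p\<close>.\<close>

lemma minimal_sublinear:
  assumes "sublinear p"
  obtains m where "sublinear m" "m \<le> p" "\<And>q. sublinear q \<Longrightarrow> q \<le> m \<Longrightarrow> q = m"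
proof -
  define A where "A = {q. sublinear q \<and> q \<le> p}"
  have "\<exists>m\<in>A. \<forall>q\<in>A. q \<le> m \<longrightarrow> q = m"
  proof (rule predicate_Zorn)
    show "partial_order_on A (relation_of (\<lambda>a b. b \<le> a) A)"
      by (rule partial_order_on_relation_ofI) auto
    fix C assume C: "C \<in> Chains (relation_of (\<lambda>a b. b \<le> a) A)"
    then have CA: "C \<subseteq> A" by (rule Chains_relation_of)
    have chain: "q \<le> q' \<or> q' \<le> q" if "q \<in> C" "q' \<in> C" for q q'
      using C that by (auto simp: Chains_def relation_of_def)
    show "\<exists>u\<in>A. \<forall>q\<in>C. u \<le> q"
    proof (cases "C = {}")
      case True
      then show ?thesis using assms by (auto simp: A_def)
    next
      case False
      define u where "u x = (INF q\<in>C. q x)" for x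
      have "- p (- x) \<le> q x" if "q \<in> C" for q x
      proof -
        have "sublinear q" "q (- x) \<le> p (- x)" using that CA by (auto simp: A_def le_fun_def)
        then show ?thesis using sublinear_uminus_le[of q x] by simp
      qed
      then have "bdd_below ((\<lambda>q. q x) ` C)" for x
        by (intro bdd_belowI2) auto
      then have lower: "u x \<le> q x" if "q \<in> C" for q x
        unfolding u_def using that by (intro cINF_lower) auto
      have greatest: "b \<le> u x" if "\<And>q. q \<in> C \<Longrightarrow> b \<le> q x" for b x
        unfolding u_def using that False by (intro cINF_greatest) auto
      have "sublinear u"
      proof (rule sublinearI)
        fix x y
        \<comment> \<open>Two different chain members may be nearly optimal at \<open>x\<close> and
          at \<open>y\<close>; the smaller of them serves both.\<close>
        have *: "u (x + y) \<le> q x + q' y" if q: "q \<in> C" "q' \<in> C" for q q'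
        proof -
          obtain q0 where q0: "q0 \<in> C" "q0 \<le> q" "q0 \<le> q'"
            using chain[OF q] q by auto
          then have "u (x + y) \<le> q0 x + q0 y"
            using lower[of q0 "x + y"] sublinear_add[of q0 x y] CA by (auto simp: A_def)
          also have "\<dots> \<le> q x + q' y" using q0 by (intro add_mono) (auto simp: le_fun_def)
          finally show ?thesis .
        qed
        have "u (x + y) - q x \<le> u y" if "q \<in> C" for q
          using *[OF that] by (intro greatest) (simp add: diff_le_eq add.commute)
        then have "u (x + y) - u y \<le> u x"
          by (intro greatest) (simp add: algebra_simps)
        then show "u (x + y) \<le> u x + u y" by simp
      next
        fix c :: real and x assume c: "0 < c"
        have "u (c *\<^sub>R x) / c \<le> q x" if "q \<in> C" for q
          using lower[OF that, of "c *\<^sub>R x"] sublinear_scaleR[of q c x] that CA c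
          by (auto simp: A_def field_simps)
        then have "u (c *\<^sub>R x) / c \<le> u x" by (intro greatest)
        then show "u (c *\<^sub>R x) \<le> c * u x" using c by (simp add: field_simps)
      qed
      moreover have "u \<le> p"
      proof -
        obtain q where "q \<in> C" using False by blast
        then have "u \<le> q" "q \<le> p" using lower CA by (auto simp: le_fun_def A_def)
        then show ?thesis by (rule order_trans)
      qed
      ultimately show ?thesis using lower by (auto simp: A_def le_fun_def)
    qed
  qed
  then obtain m where "m \<in> A" and m: "\<And>q. q \<in> A \<Longrightarrow> q \<le> m \<Longrightarrow> q = m" by blast
  then show ?thesis
    using that[of m] by (auto simp: A_def intro: order_trans)
qed

text \<open>Shifting a minimal \<open>m\<close> along \<open>y\<close> cannot lower it, so
  \<open>m (- y) = - m y\<close>. Oddness turns subadditivity into additivity.\<close>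

lemma sublinear_dominates_linear:
  assumes "sublinear p"
  obtains f where "linear f" "\<And>x. f x \<le> p x"
proof -
  obtain m where m: "sublinear m" "m \<le> p" and min: "\<And>q. sublinear q \<Longrightarrow> q \<le> m \<Longrightarrow> q = m"
    by (rule minimal_sublinear[OF assms]) blast
  have minus: "m (- y) = - m y" for y
  proof -
    obtain r where "sublinear r" "r \<le> m" "r (- y) \<le> - m y"
      by (rule sublinear_shift[OF m(1)])
    then show ?thesis using min[of r] sublinear_uminus_le[OF m(1), of "- y"] by simp
  qed
  have "linear m"
  proof (rule linearI)
    fix x y and c :: real
    show "m (x + y) = m x + m y"
      using sublinear_add[OF m(1), of x y] sublinear_add[OF m(1), of "x + y" "- y"] minus[of y]
      by simp
    show "m (c *\<^sub>R x) = c *\<^sub>R m x"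
      using sublinear_scaleR[OF m(1), of c x] sublinear_scaleR[OF m(1), of "- c" x]
        minus[of "c *\<^sub>R x"] by (cases "0 \<le> c") auto
  qed
  then show ?thesis using m(2) that by (auto simp: le_fun_def)
qed

lemma pprt_add_le: "pprt (x + y) \<le> pprt x + pprt (y::'a::banach_lattice)"
  unfolding pprt_def
  by (intro sup_least add_mono) (simp_all add: add_nonneg_nonneg)

lemma pprt_scaleR_le:
  assumes "0 \<le> c"
  shows "pprt (c *\<^sub>R x) \<le> c *\<^sub>R pprt (x::'a::banach_lattice)"
  using assms unfolding pprt_def
  by (intro sup_least scaleR_left_mono scaleR_nonneg_nonneg) auto

lemma ex_norming_functional:
  fixes z :: "'a::banach_lattice"
  assumes "0 \<le> z"
  obtains f :: "'a \<Rightarrow>\<^sub>L real" where "0 \<le> f" "norm f \<le> 1" "f z = norm z"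
proof -
  \<comment> \<open>Using the norm of the positive part instead of the norm makes every dominated
    linear functional positive, as \<open>p (- x) = 0\<close> for \<open>x \<ge> 0\<close>.\<close>
  define p where "p x = norm (pprt x)" for x :: 'a
  have "sublinear p"
  proof (rule sublinearI)
    fix x y :: 'a and c :: real
    show "p (x + y) \<le> p x + p y"
      unfolding p_def
      by (rule order_trans[OF norm_mono_nonneg[OF _ pprt_add_le] norm_triangle_ineq]) simp
    show "p (c *\<^sub>R x) \<le> c * p x" if "0 < c"
      using norm_mono_nonneg[OF _ pprt_scaleR_le[of c x]] that by (simp add: p_def)
  qed
  \<comment> \<open>Shifting along \<open>z\<close> first forces any linear functional below
    \<open>r\<close> to be at least \<open>norm z\<close> at \<open>z\<close>.\<close>
  then obtain r where r: "sublinear r" "r \<le> p" "r (- z) \<le> - p z"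
    by (rule sublinear_shift)
  obtain f where f: "linear f" "\<And>x. f x \<le> r x"
    by (rule sublinear_dominates_linear[OF r(1)]) blast
  have fp: "f x \<le> p x" for x using f(2)[of x] r(2) by (auto simp: le_fun_def intro: order_trans)
  have minus: "f (- x) = - f x" for x using f(1) by (rule linear_neg)
  have bound: "\<bar>f x\<bar> \<le> norm x" for x
    using fp[of x] fp[of "- x"] norm_pprt_le[of x] norm_pprt_le[of "- x"]
    by (simp add: p_def minus)
  have bl: "bounded_linear f"
    using bound by (intro bounded_linear_intro[where K = 1])
      (auto simp: linear_add[OF f(1)] linear_scale[OF f(1)])
  have app: "blinfun_apply (Blinfun f) x = f x" for x
    using bl by (simp add: bounded_linear_Blinfun_apply)
  show ?thesis
  proof
    show "0 \<le> Blinfun f"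
      unfolding dual_nonneg_iff app
    proof (intro allI impI)
      fix x :: 'a assume "0 \<le> x"
      then show "0 \<le> f x" using fp[of "- x"] minus[of x] by (simp add: p_def)
    qed
    show "norm (Blinfun f) \<le> 1"
      using bound by (intro norm_blinfun_bound) (auto simp: app)
    have "norm z \<le> f z"
      using f(2)[of "- z"] r(3) minus[of z] assms by (simp add: p_def)
    then show "Blinfun f z = norm z"
      using bound[of z] by (simp add: app)
  qed
qed

section \<open>Components of functionals\<close>

text \<open>For \<open>0 \<le> f\<close> and \<open>0 \<le> z\<close>, this is the restriction of \<open>f\<close> to the ideal generated by \<open>z\<close>,
  extended by zero to the elements disjoint from \<open>z\<close>.\<close>

definition dual_component :: "('a::banach_lattice \<Rightarrow>\<^sub>L real) \<Rightarrow> 'a \<Rightarrow> 'a \<Rightarrow>\<^sub>L real"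
  where "dual_component f z =
    (SOME g. \<forall>x\<ge>0. blinfun_apply g x = (SUP k::nat. f (inf x (real k *\<^sub>R z))))"

context
  fixes f :: "'a::banach_lattice \<Rightarrow>\<^sub>L real" and z :: 'a
  assumes f: "0 \<le> f" and z: "0 \<le> z"
begin

lemma dual_component_upper':
  "f (inf x (real k *\<^sub>R z)) \<le> (SUP k::nat. f (inf x (real k *\<^sub>R z)))"
  by (intro cSUP_upper bdd_aboveI2[where M = "f x"] dual_apply_mono f) auto

text \<open>The supremum is additive and positively homogeneous on the cone and bounded by
  \<open>norm f * norm x\<close>. It therefore extends to a functional, which justifies the choice
  in \<open>dual_component\<close>.\<close>

lemma dual_component_apply:
  assumes "0 \<le> x"
  shows "dual_component f z x = (SUP k::nat. f (inf x (real k *\<^sub>R z)))"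
proof -
  define \<phi> where "\<phi> x = (SUP k::nat. f (inf x (real k *\<^sub>R z)))" for x
  have upper: "f (inf x (real k *\<^sub>R z)) \<le> \<phi> x" for x k
    unfolding \<phi>_def by (rule dual_component_upper')
  have least: "\<phi> x \<le> b" if "\<And>k. f (inf x (real k *\<^sub>R z)) \<le> b" for x b
    unfolding \<phi>_def using that by (intro cSUP_least) auto
  have kz: "0 \<le> real k *\<^sub>R z" for k
    using z by (intro scaleR_nonneg_nonneg) auto
  have scale_le: "\<phi> (c *\<^sub>R x) \<le> c * \<phi> x" if "0 \<le> x" "0 < c" for x c
  proof (rule least)
    fix k :: nat
    \<comment> \<open>The truncation level is rescaled to an integer; rounding up only enlarges the
      truncation.\<close>
    obtain l :: nat where "real k / c \<le> real l" using real_arch_simple by blast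
    then have "real k \<le> c * real l" using that by (simp add: field_simps)
    then have "real k *\<^sub>R z \<le> (c * real l) *\<^sub>R z" using z by (intro scaleR_mono_left_nonneg)
    then have "inf (c *\<^sub>R x) (real k *\<^sub>R z) \<le> inf (c *\<^sub>R x) (c *\<^sub>R real l *\<^sub>R z)"
      by (intro inf_mono) auto
    also have "\<dots> = c *\<^sub>R inf x (real l *\<^sub>R z)" using that by (intro inf_scaleR)
    finally have "f (inf (c *\<^sub>R x) (real k *\<^sub>R z)) \<le> c * f (inf x (real l *\<^sub>R z))"
      using dual_apply_mono[OF f] by (fastforce simp: blinfun.scaleR_right)
    also have "\<dots> \<le> c * \<phi> x" using that by (intro mult_left_mono upper) auto
    finally show "f (inf (c *\<^sub>R x) (real k *\<^sub>R z)) \<le> c * \<phi> x" .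
  qed
  obtain g :: "'a \<Rightarrow>\<^sub>L real" where g: "\<And>x. 0 \<le> x \<Longrightarrow> g x = \<phi> x"
  proof (rule positive_functional_extend[of \<phi> "norm f"])
    fix x y :: 'a and c :: real
    assume x: "0 \<le> x"
    show "0 \<le> \<phi> x" using upper[of x 0] x by (simp add: inf_absorb2)
    show "\<phi> x \<le> norm f * norm x"
    proof (rule least)
      fix k
      have "f (inf x (real k *\<^sub>R z)) \<le> f x" by (intro dual_apply_mono f) simp
      also have "\<dots> \<le> norm f * norm x" using norm_blinfun[of f x] by simp
      finally show "f (inf x (real k *\<^sub>R z)) \<le> norm f * norm x" .
    qed
    show "\<phi> (c *\<^sub>R x) = c * \<phi> x" if c: "0 < c"
    proof (rule antisym[OF scale_le[OF x c]])
      have "\<phi> (inverse c *\<^sub>R c *\<^sub>R x) \<le> inverse c * \<phi> (c *\<^sub>R x)"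
        using x c by (intro scale_le scaleR_nonneg_nonneg) auto
      then show "c * \<phi> x \<le> \<phi> (c *\<^sub>R x)" using c by (simp add: field_simps)
    qed
    show "\<phi> (x + y) = \<phi> x + \<phi> y" if y: "0 \<le> y"
    proof (rule antisym)
      show "\<phi> (x + y) \<le> \<phi> x + \<phi> y"
      proof (rule least)
        fix k
        have "inf (x + y) (real k *\<^sub>R z) \<le> inf x (real k *\<^sub>R z) + inf y (real k *\<^sub>R z)"
          using inf_add_le[OF x y kz[of k]] by (simp add: inf_commute)
        then have "f (inf (x + y) (real k *\<^sub>R z)) \<le> f (inf x (real k *\<^sub>R z)) + f (inf y (real k *\<^sub>R z))"
          using dual_apply_mono[OF f] by (fastforce simp: blinfun.add_right)
        also have "\<dots> \<le> \<phi> x + \<phi> y" by (intro add_mono upper)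
        finally show "f (inf (x + y) (real k *\<^sub>R z)) \<le> \<phi> x + \<phi> y" .
      qed
      \<comment> \<open>Superadditivity: truncations at levels \<open>k\<close> and \<open>l\<close>
        add up to something below the truncation at level \<open>k + l\<close>.\<close>
      have "f (inf x (real k *\<^sub>R z)) + f (inf y (real l *\<^sub>R z)) \<le> \<phi> (x + y)" for k l
      proof -
        have "inf x (real k *\<^sub>R z) + inf y (real l *\<^sub>R z) \<le> real k *\<^sub>R z + real l *\<^sub>R z"
          by (intro add_mono) auto
        then have "inf x (real k *\<^sub>R z) + inf y (real l *\<^sub>R z) \<le> inf (x + y) (real (k + l) *\<^sub>R z)"
          by (intro inf_greatest add_mono) (auto simp: scaleR_add_left)
        then have "f (inf x (real k *\<^sub>R z) + inf y (real l *\<^sub>R z)) \<le> f (inf (x + y) (real (k + l) *\<^sub>R z))"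
          by (rule dual_apply_mono[OF f])
        also have "\<dots> \<le> \<phi> (x + y)" by (rule upper)
        finally show ?thesis by (simp add: blinfun.add_right)
      qed
      then have "\<phi> y \<le> \<phi> (x + y) - f (inf x (real k *\<^sub>R z))" for k
        by (intro least) (simp add: algebra_simps)
      then have "\<phi> x \<le> \<phi> (x + y) - \<phi> y"
        by (intro least) (simp add: algebra_simps)
      then show "\<phi> x + \<phi> y \<le> \<phi> (x + y)" by simp
    qed
  qed blast
  then have "\<exists>g. \<forall>x\<ge>0. blinfun_apply g x = (SUP k::nat. f (inf x (real k *\<^sub>R z)))"
    unfolding \<phi>_def by blast
  from someI_ex[OF this] show ?thesis using assms unfolding dual_component_def by blast
qed

lemma dual_component_upper: "0 \<le> x \<Longrightarrow> f (inf x (real k *\<^sub>R z)) \<le> dual_component f z x"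
  using dual_component_upper' by (simp add: dual_component_apply)

lemma dual_component_nonneg: "0 \<le> dual_component f z"
  unfolding dual_nonneg_iff
  using dual_component_upper[of _ 0] by (auto simp: inf_absorb2)

lemma dual_component_le: "dual_component f z \<le> f"
  unfolding less_eq_blinfun_def
  by (auto simp: dual_component_apply intro!: cSUP_least dual_apply_mono f)

lemma dual_component_eq:
  assumes "0 \<le> x" "x \<le> real k *\<^sub>R z"
  shows "dual_component f z x = f x"
  using dual_component_upper[of x k] dual_le_apply[OF dual_component_le, of x] assms
  by (simp add: inf_absorb1)

lemma dual_component_disjoint:
  assumes "inf x z = 0"
  shows "dual_component f z x = 0"
proof -
  have "inf x (real k *\<^sub>R z) = 0" for k
    using disjoint_scaleR[OF assms, of 1 "real k"] by simp
  moreover have "0 \<le> x" by (simp add: assms[symmetric])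
  ultimately show ?thesis by (simp add: dual_component_apply)
qed

text \<open>The component agrees with \<open>f\<close> on each truncation of \<open>x\<close>, and
  these values approach its value at \<open>x\<close>, so the remainder gets little mass.\<close>

lemma dual_component_approx:
  assumes "0 \<le> x" "0 < \<delta>"
  obtains k :: nat where "dual_component f z (x - inf x (real k *\<^sub>R z)) < \<delta>"
proof -
  have "\<exists>k::nat. dual_component f z x - \<delta> < f (inf x (real k *\<^sub>R z))"
  proof (rule ccontr)
    assume "\<not> ?thesis"
    then have "dual_component f z x \<le> dual_component f z x - \<delta>"
      by (subst dual_component_apply[OF assms(1)]) (auto intro!: cSUP_least simp: not_less)
    then show False using assms by simp
  qed
  then obtain k :: nat where k: "dual_component f z x - \<delta> < f (inf x (real k *\<^sub>R z))" ..
  have "dual_component f z (inf x (real k *\<^sub>R z)) = f (inf x (real k *\<^sub>R z))"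
    using assms z by (intro dual_component_eq[of _ k]) (auto intro: scaleR_nonneg_nonneg)
  then have "dual_component f z x - dual_component f z (inf x (real k *\<^sub>R z)) < \<delta>"
    using k by linarith
  then show ?thesis by (intro that[of k]) (simp only: blinfun.diff_right)
qed

end

text \<open>Split \<open>x\<close> into its truncation by a multiple of \<open>z\<close> and the
  rest. The truncation is disjoint from \<open>w\<close>, so the second component vanishes there;
  the first is small on the rest.\<close>

lemma inf_dual_component:
  fixes f g :: "'a::banach_lattice \<Rightarrow>\<^sub>L real"
  assumes "0 \<le> f" "0 \<le> g" "inf z w = 0"
  shows "inf (dual_component f z) (dual_component g w) = 0"
proof (rule antisym)
  have zw: "0 \<le> z" "0 \<le> w" by (simp_all add: assms(3)[symmetric])
  let ?f = "dual_component f z" and ?g = "dual_component g w"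
  show "0 \<le> inf ?f ?g" using dual_component_nonneg assms zw by auto
  show "inf ?f ?g \<le> 0"
    unfolding less_eq_blinfun_def
  proof (intro allI impI)
    fix x :: 'a assume x: "0 \<le> x"
    have "inf ?f ?g x \<le> \<delta>" if \<delta>: "0 < \<delta>" for \<delta>
    proof -
      obtain k :: nat where k: "?f (x - inf x (real k *\<^sub>R z)) < \<delta>"
        using dual_component_approx[OF assms(1) zw(1) x \<delta>] by blast
      let ?u = "inf x (real k *\<^sub>R z)"
      have u: "0 \<le> ?u" using x zw by (auto intro: scaleR_nonneg_nonneg)
      have "inf (real k *\<^sub>R z) w = 0"
        using disjoint_scaleR[OF assms(3), of "real k" 1] by simp
      then have "inf ?u w = 0"
        by (rule disjoint_mono) (use u zw in auto)
      then have "inf ?f ?g ?u \<le> 0"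
        using dual_le_apply[OF inf_le2 u, of ?f ?g] dual_component_disjoint[OF assms(2) zw(2)]
        by simp
      moreover have "inf ?f ?g (x - ?u) < \<delta>"
        using dual_le_apply[OF inf_le1[of ?f ?g], of "x - ?u"] k
        by (meson inf_le1 diff_ge_0_iff_ge le_less_trans)
      ultimately show ?thesis by (simp only: blinfun.diff_right)
    qed
    then show "inf ?f ?g x \<le> blinfun_apply 0 x"
      using field_le_epsilon[of "inf ?f ?g x" 0] by simp
  qed
qed

section \<open>L-weak compactness and disjoint sequences: passing from vectors to
  functionals\<close>

lemma L_weakly_compact_dual_tendsto:
  fixes A :: "('a::banach_lattice \<Rightarrow>\<^sub>L real) set"
  assumes "L_weakly_compact A" "disjoint_seq x" "range x \<subseteq> cball 0 1" "\<And>n. f n \<in> A"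
  shows "(\<lambda>n. f n (x n)) \<longlonglongrightarrow> 0"
proof -
  \<comment> \<open>Restricting to the ideal of \<open>\<bar>x n\<bar>\<close> makes the moduli
    disjoint without changing their value at \<open>\<bar>x n\<bar>\<close>, so
    \<open>norm (g n)\<close> still controls \<open>f n (x n)\<close>.\<close>
  define g where "g n = dual_component \<bar>f n\<bar> \<bar>x n\<bar>" for n
  have g: "0 \<le> g n" "g n \<le> \<bar>f n\<bar>" for n
    unfolding g_def by (intro dual_component_nonneg dual_component_le abs_ge_zero)+
  have "disjoint_seq g"
    using assms(2) g(1) unfolding disjoint_seq_def
    by (auto simp: g_def intro: inf_dual_component)
  moreover have "range g \<subseteq> solid_hull A"
    using g assms(4) unfolding solid_hull_def by fastforce
  ultimately have lim: "(\<lambda>n. norm (g n)) \<longlonglongrightarrow> 0"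
    using assms(1) by (simp add: L_weakly_compact_def)
  show ?thesis
  proof (rule Lim_null_comparison[OF _ lim], rule always_eventually, rule allI)
    fix n
    have "norm (f n (x n)) \<le> \<bar>f n\<bar> \<bar>x n\<bar>" by (simp add: dual_abs_apply_le)
    also have "\<dots> = g n \<bar>x n\<bar>"
      unfolding g_def by (intro dual_component_eq[of _ _ _ 1, symmetric]) auto
    also have "\<dots> \<le> norm (g n) * norm (x n)"
      using norm_blinfun[of "g n" "\<bar>x n\<bar>"] by (simp add: norm_abs_eq)
    also have "\<dots> \<le> norm (g n)"
      using assms(3) by (intro mult_left_le) (auto simp: image_subset_iff)
    finally show "norm (f n (x n)) \<le> norm (g n)" .
  qed
qed

lemma L_weakly_compactI_dual:
  fixes A :: "'a::banach_lattice set"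
  assumes "A \<noteq> {}" "bounded A"
    and tendsto: "\<And>g a. disjoint_seq g \<Longrightarrow> range g \<subseteq> cball 0 1 \<Longrightarrow>
      (\<And>n. a n \<in> A) \<Longrightarrow> (\<lambda>n. blinfun_apply (g n) (a n) :: real) \<longlonglongrightarrow> 0"
  shows "L_weakly_compact A"
proof (rule L_weakly_compactI[OF assms(1,2)])
  fix y :: "nat \<Rightarrow> 'a" and \<epsilon> :: real
  assume y: "disjoint_seq y" "range y \<subseteq> solid_hull A" and \<epsilon>: "0 < \<epsilon>" "\<And>n. \<epsilon> \<le> norm (y n)"
  have "\<forall>n. \<exists>a. a \<in> A \<and> \<bar>y n\<bar> \<le> \<bar>a\<bar>" using y(2) by (auto simp: solid_hull_def)
  then obtain a where a: "\<And>n. a n \<in> A" "\<And>n. \<bar>y n\<bar> \<le> \<bar>a n\<bar>" by metis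
  \<comment> \<open>Since \<open>\<bar>y n\<bar>\<close> is below the sum of the two parts of
    \<open>a n\<close>, one part retains half the norm. Working under a single part prevents
    cancellation when a functional is applied to \<open>a n\<close>.\<close>
  have "\<exists>s. (s = a n \<or> s = - a n) \<and> \<epsilon> / 2 \<le> norm (inf \<bar>y n\<bar> (pprt s))" for n
  proof -
    define p q where "p = inf \<bar>y n\<bar> (pprt (a n))" and "q = inf \<bar>y n\<bar> (pprt (- a n))"
    have "\<bar>y n\<bar> = inf \<bar>y n\<bar> (pprt (a n) + pprt (- a n))"
      using a(2)[of n] by (simp add: pprt_add inf_absorb1)
    also have "\<dots> \<le> p + q"
      unfolding p_def q_def by (intro inf_add_le) auto
    finally have "norm \<bar>y n\<bar> \<le> norm (p + q)"
      by (intro norm_mono_nonneg) auto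
    then have "\<epsilon> \<le> norm p + norm q"
      using \<epsilon>(2)[of n] norm_triangle_ineq[of p q] by (simp add: norm_abs_eq)
    then have "\<epsilon> / 2 \<le> norm p \<or> \<epsilon> / 2 \<le> norm q"
      by linarith
    then have "\<epsilon> / 2 \<le> norm (inf \<bar>y n\<bar> (pprt (a n))) \<or> \<epsilon> / 2 \<le> norm (inf \<bar>y n\<bar> (pprt (- a n)))"
      unfolding p_def q_def .
    then show ?thesis by blast
  qed
  then obtain s where s: "\<And>n. s n = a n \<or> s n = - a n"
      "\<And>n. \<epsilon> / 2 \<le> norm (inf \<bar>y n\<bar> (pprt (s n)))"
    by metis
  define z where "z n = inf \<bar>y n\<bar> (pprt (s n))" for n
  have z: "0 \<le> z n" "z n \<le> pprt (s n)" "\<bar>z n\<bar> \<le> \<bar>y n\<bar>" for n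
    by (simp_all add: z_def)
  have "\<exists>f. 0 \<le> f \<and> norm f \<le> 1 \<and> blinfun_apply f (z n) = norm (z n)" for n
    by (rule ex_norming_functional[OF z(1)]) blast
  then obtain f :: "nat \<Rightarrow> 'a \<Rightarrow>\<^sub>L real"
    where f: "\<And>n. 0 \<le> f n" "\<And>n. norm (f n) \<le> 1" "\<And>n. f n (z n) = norm (z n)"
    by metis
  \<comment> \<open>Besides making the functionals disjoint, this kills the opposite part
    \<open>pprt (- s n)\<close> while keeping the value \<open>norm (z n)\<close> at
    \<open>z n\<close>.\<close>
  define g where "g n = dual_component (f n) (z n)" for n
  have g: "0 \<le> g n" "g n \<le> f n" for n
    unfolding g_def by (intro dual_component_nonneg dual_component_le f z)+
  have "disjoint_seq z" by (rule disjoint_seq_abs_mono[OF y(1) z(3)])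
  then have "disjoint_seq g"
    using z(1) f(1) g(1) by (auto simp: disjoint_seq_def g_def intro: inf_dual_component)
  moreover have "range g \<subseteq> cball 0 1"
    using norm_mono_nonneg[OF g] f(2) order_trans by (fastforce simp: image_subset_iff)
  ultimately have "(\<lambda>n. g n (a n)) \<longlonglongrightarrow> 0" using a(1) by (rule tendsto)
  then have "\<forall>\<^sub>F n in sequentially. \<bar>g n (a n)\<bar> < \<epsilon> / 2"
    using \<epsilon>(1) by (auto simp: tendsto_iff dist_real_def dest!: spec[of _ "\<epsilon> / 2"])
  then obtain n where n: "\<bar>g n (a n)\<bar> < \<epsilon> / 2" by (auto simp: eventually_sequentially)
  have "inf (pprt (- s n)) (z n) = 0"
    using inf_pprt_pprt_uminus[of "- s n"] z by (auto intro: disjoint_mono)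
  then have "g n (pprt (- s n)) = 0"
    unfolding g_def by (intro dual_component_disjoint f z)
  then have "g n (s n) = g n (pprt (s n))"
    using blinfun.diff_right[of "g n" "pprt (s n)" "pprt (- s n)"] by (simp add: pprt_diff)
  moreover have "g n (z n) = f n (z n)"
    unfolding g_def using z f by (intro dual_component_eq[of _ _ _ 1]) auto
  moreover have "g n (z n) \<le> g n (pprt (s n))"
    by (intro dual_apply_mono g z)
  ultimately have "\<epsilon> / 2 \<le> g n (s n)"
    using f(3)[of n] s(2)[of n] by (simp add: z_def)
  then show False
    using n s(1)[of n] by (auto simp: blinfun.minus_right)
qed


section \<open>From disjoint functionals to disjoint vectors\<close>

lemma member_le_sum_nonneg:
  fixes x :: "'i \<Rightarrow> 'a::ordered_comm_monoid_add"
  assumes "finite I" "i \<in> I" "\<And>j. j \<in> I \<Longrightarrow> 0 \<le> x j"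
  shows "x i \<le> sum x I"
  using sum_mono2[of I "{i}" x] assms by auto

text \<open>Each pair of functionals is nearly separated by splitting a common majorant
  \<open>X\<close>. Subtracting all the pieces \<open>r i j\<close>, nearly null for
  \<open>f i\<close>, from \<open>x i\<close> leaves disjoint positive parts.\<close>

lemma finite_disjoint_approx:
  fixes f :: "nat \<Rightarrow> 'a::banach_lattice \<Rightarrow>\<^sub>L real"
  assumes "finite I" and f: "\<And>i. 0 \<le> f i" "\<And>i j. i \<noteq> j \<Longrightarrow> inf (f i) (f j) = 0"
    and x: "\<And>i. i \<in> I \<Longrightarrow> 0 \<le> x i" and "0 < \<delta>"
  obtains V where "\<And>i. i \<in> I \<Longrightarrow> 0 \<le> V i" "\<And>i. i \<in> I \<Longrightarrow> V i \<le> x i"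
    "\<And>i j. i \<in> I \<Longrightarrow> j \<in> I \<Longrightarrow> i \<noteq> j \<Longrightarrow> inf (V i) (V j) = 0"
    "\<And>i. i \<in> I \<Longrightarrow> f i (x i) - \<delta> \<le> f i (V i)"
proof -
  define X where "X = (\<Sum>i\<in>I. x i)"
  have X: "0 \<le> X" unfolding X_def using x by (intro sum_nonneg)
  have xX: "x i \<le> X" if "i \<in> I" for i
    unfolding X_def using assms(1) x that by (intro member_le_sum_nonneg) auto
  \<comment> \<open>At most \<open>card I\<close> pieces cost at most \<open>2 * \<eta>\<close>
    each; the added \<open>1\<close> keeps the denominator positive for empty
    \<open>I\<close>.\<close>
  define \<eta> where "\<eta> = \<delta> / (2 * (card I + 1))"
  have \<eta>: "0 < \<eta>" using assms(5) by (simp add: \<eta>_def)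
  have "\<exists>u. 0 \<le> u \<and> u \<le> X \<and> (i \<noteq> j \<longrightarrow> blinfun_apply (f i) (X - u) < \<eta> \<and> blinfun_apply (f j) u < \<eta>)" for i j
  proof (cases "i = j")
    case False
    show ?thesis
      by (rule dual_disjoint_approx[OF f(2)[OF False] X \<eta>]) blast
  qed (use X in auto)
  then obtain u where u: "\<And>i j. 0 \<le> u i j" "\<And>i j. u i j \<le> X"
      "\<And>i j. i \<noteq> j \<Longrightarrow> f i (X - u i j) < \<eta>" "\<And>i j. i \<noteq> j \<Longrightarrow> f j (u i j) < \<eta>"
    by metis
  \<comment> \<open>Symmetrized so that \<open>X - r i j = u i j - u j i\<close> is antisymmetric:
    swapping \<open>i\<close> and \<open>j\<close> exchanges its positive and negative parts, which
    are disjoint.\<close>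
  define r where "r i j = (X - u i j) + u j i" for i j
  have r: "0 \<le> r i j" for i j
    unfolding r_def using u by (intro add_nonneg_nonneg) auto
  have r_swap: "X - r j i = - (X - r i j)" for i j
    by (simp add: r_def algebra_simps)
  have f_r: "f i (r i j) \<le> 2 * \<eta>" if "i \<noteq> j" for i j
    using u(3)[OF that] u(4)[of j i] that unfolding r_def blinfun.add_right by simp
  define V where "V i = pprt (x i - (\<Sum>j\<in>I - {i}. r i j))" for i
  show ?thesis
  proof
    fix i assume i: "i \<in> I"
    have s: "0 \<le> (\<Sum>j\<in>I - {i}. r i j)" by (intro sum_nonneg r)
    show "0 \<le> V i" by (simp add: V_def)
    show "V i \<le> x i" unfolding V_def pprt_def using s x[OF i] by simp
    have "f i (\<Sum>j\<in>I - {i}. r i j) = (\<Sum>j\<in>I - {i}. f i (r i j))"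
      by (simp add: blinfun.sum_right)
    also have "\<dots> \<le> (\<Sum>j\<in>I - {i}. 2 * \<eta>)"
      by (intro sum_mono f_r) auto
    also have "\<dots> \<le> (\<Sum>j\<in>I. 2 * \<eta>)"
      using assms(1) \<eta> by (intro sum_mono2) auto
    also have "\<dots> \<le> \<delta>"
      using assms(5) by (simp add: \<eta>_def field_simps)
    finally have "f i (x i) - \<delta> \<le> f i (x i - (\<Sum>j\<in>I - {i}. r i j))"
      by (simp only: blinfun.diff_right)
    also have "\<dots> \<le> f i (V i)"
      unfolding V_def pprt_def by (intro dual_apply_mono f) simp
    finally show "f i (x i) - \<delta> \<le> f i (V i)" .
  next
    have V_le: "V i \<le> pprt (X - r i j)" if "i \<in> I" "j \<in> I" "i \<noteq> j" for i j
    proof -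
      have "r i j \<le> (\<Sum>j\<in>I - {i}. r i j)"
        using assms(1) r that by (intro member_le_sum_nonneg) auto
      then show ?thesis
        unfolding V_def using xX[OF that(1)] by (intro pprt_mono diff_mono)
    qed
    fix i j assume ij: "i \<in> I" "j \<in> I" "i \<noteq> j"
    have "inf (pprt (X - r i j)) (pprt (X - r j i)) = 0"
      unfolding r_swap[of j i] by (rule inf_pprt_pprt_uminus)
    then show "inf (V i) (V j) = 0"
      by (rule disjoint_mono) (use ij V_le[of i j] V_le[of j i] in \<open>auto simp: V_def\<close>)
  qed
qed

text \<open>Among sufficiently many disjoint elements \<open>V i \<le> x i\<close> there is, for each \<open>m\<close>, one on which
  the part of \<open>x m\<close> below a multiple of \<open>V i\<close> is negligible for \<open>f m\<close>; the pigeonhole principle makes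
  the choice of \<open>i\<close> independent of \<open>m\<close>. The common bound \<open>e\<close> makes \<open>V i\<close>, shrunk a
  little, disjoint from what remains of every \<open>x m\<close> at once.\<close>

lemma disjoint_step:
  fixes f :: "nat \<Rightarrow> 'a::banach_lattice \<Rightarrow>\<^sub>L real"
  assumes f: "\<And>i. 0 \<le> f i" "\<And>i j. i \<noteq> j \<Longrightarrow> inf (f i) (f j) = 0"
    and M: "infinite M" and x: "\<And>m. m \<in> M \<Longrightarrow> 0 \<le> x m" "\<And>m. m \<in> M \<Longrightarrow> x m \<le> c m *\<^sub>R e"
    and c: "\<And>m. 0 < c m" and e: "0 \<le> e"
    and K: "\<And>m. m \<in> M \<Longrightarrow> f m (x m) \<le> K" "\<And>m. m \<in> M \<Longrightarrow> f m e \<le> K"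
    and \<theta>: "\<And>m. m \<in> M \<Longrightarrow> \<theta> \<le> f m (x m)" and \<delta>: "0 < \<delta>"
  obtains i y M' x' where "i \<in> M" "0 \<le> y" "y \<le> x i" "\<theta> - \<delta> \<le> f i y"
    "infinite M'" "M' \<subseteq> M" "\<And>m. m \<in> M' \<Longrightarrow> 0 \<le> x' m" "\<And>m. m \<in> M' \<Longrightarrow> x' m \<le> x m"
    "\<And>m. m \<in> M' \<Longrightarrow> \<theta> - \<delta> \<le> f m (x' m)" "\<And>m. m \<in> M' \<Longrightarrow> inf y (x' m) = 0"
proof -
  \<comment> \<open>With \<open>N\<close> disjoint pieces, values above \<open>\<delta>\<close> on
    all of them would add up to more than \<open>K\<close>, the bound for
    \<open>f m (x m)\<close>.\<close>
  obtain N :: nat where N: "K / \<delta> < real N" using reals_Archimedean2 by blast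
  obtain I where I: "finite I" "card I = N" "I \<subseteq> M"
    using infinite_arbitrarily_large[OF M] by blast
  have xI: "0 \<le> x i" if "i \<in> I" for i using I x that by auto
  obtain V where V: "\<And>i. i \<in> I \<Longrightarrow> 0 \<le> V i" "\<And>i. i \<in> I \<Longrightarrow> V i \<le> x i"
      "\<And>i j. i \<in> I \<Longrightarrow> j \<in> I \<Longrightarrow> i \<noteq> j \<Longrightarrow> inf (V i) (V j) = 0"
      "\<And>i. i \<in> I \<Longrightarrow> f i (x i) - \<delta> / 2 \<le> f i (V i)"
    by (rule finite_disjoint_approx[where f = f and x = x, OF I(1) f xI half_gt_zero[OF \<delta>]]) blast+
  \<comment> \<open>Shrinking by \<open>e / D\<close> costs at most \<open>K / D\<close>, hence at
    most \<open>\<delta> / 2\<close>; the other half of \<open>\<delta>\<close> was spent on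
    \<open>V\<close>.\<close>
  define D where "D = 2 * (\<bar>K\<bar> + 1) / \<delta>"
  have D: "0 < D" "K / D \<le> \<delta> / 2"
  proof -
    show D0: "0 < D" using \<delta> by (simp add: D_def)
    have "K \<le> \<bar>K\<bar> + 1" by simp
    also have "\<dots> = \<delta> / 2 * D" using \<delta> by (simp add: D_def)
    finally show "K / D \<le> \<delta> / 2" using D0 by (simp add: pos_divide_le_eq)
  qed
  have cD: "0 < c m * D" for m using c D by simp
  have "\<exists>i\<in>I. f m (inf (x m) ((c m * D) *\<^sub>R V i)) \<le> \<delta>" if m: "m \<in> M" for m
  proof (rule ccontr)
    assume neg: "\<not> ?thesis"
    have "real N * \<delta> = (\<Sum>i\<in>I. \<delta>)" using I by simp
    also have "\<dots> \<le> (\<Sum>i\<in>I. f m (inf (x m) ((c m * D) *\<^sub>R V i)))"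
      using neg by (intro sum_mono) (simp add: not_le less_imp_le)
    also have "\<dots> = f m (\<Sum>i\<in>I. inf (x m) ((c m * D) *\<^sub>R V i))"
      by (simp add: blinfun.sum_right)
    also have "\<dots> \<le> f m (x m)"
      using I(1) x(1)[OF m] V cD[of m]
      by (intro dual_apply_mono f sum_inf_disjoint disjoint_scaleR scaleR_nonneg_nonneg) auto
    also have "\<dots> \<le> K" by (rule K(1)[OF m])
    finally show False using N \<delta> by (simp add: field_simps)
  qed
  then obtain i where i: "i \<in> I"
      and inf: "infinite {m \<in> M. f m (inf (x m) ((c m * D) *\<^sub>R V i)) \<le> \<delta>}"
    using pigeonhole_infinite_rel[OF M I(1), of "\<lambda>m i. f m (inf (x m) ((c m * D) *\<^sub>R V i)) \<le> \<delta>"]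
    by blast
  define y where "y = pprt (V i - inverse D *\<^sub>R e)"
  define x' where "x' m = x m - inf (x m) ((c m * D) *\<^sub>R V i)" for m
  have De: "0 \<le> inverse D *\<^sub>R e" using D e by (intro scaleR_nonneg_nonneg) auto
  show ?thesis
  proof
    show "i \<in> M" using i I by auto
    show "0 \<le> y" by (simp add: y_def)
    show "y \<le> x i"
      unfolding y_def pprt_def using V(1,2)[OF i] De x(1) \<open>i \<in> M\<close>
      by (intro sup_least) (auto simp: diff_le_eq intro: add_increasing2)
    have "\<theta> - \<delta> / 2 \<le> f i (V i)"
      using V(4)[OF i] \<theta>[OF \<open>i \<in> M\<close>] by linarith
    moreover have "f i (inverse D *\<^sub>R e) \<le> K / D"
      using K(2)[OF \<open>i \<in> M\<close>] D by (simp add: blinfun.scaleR_right field_simps)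
    ultimately have "\<theta> - \<delta> \<le> f i (V i - inverse D *\<^sub>R e)"
      using D(2) unfolding blinfun.diff_right by linarith
    also have "\<dots> \<le> f i y"
      unfolding y_def pprt_def by (intro dual_apply_mono f) simp
    finally show "\<theta> - \<delta> \<le> f i y" .
    show "infinite {m \<in> M. f m (inf (x m) ((c m * D) *\<^sub>R V i)) \<le> \<delta>}" by (rule inf)
    show "{m \<in> M. f m (inf (x m) ((c m * D) *\<^sub>R V i)) \<le> \<delta>} \<subseteq> M" by blast
    fix m assume "m \<in> {m \<in> M. f m (inf (x m) ((c m * D) *\<^sub>R V i)) \<le> \<delta>}"
    then have m: "m \<in> M" "f m (inf (x m) ((c m * D) *\<^sub>R V i)) \<le> \<delta>" by auto
    show "0 \<le> x' m" unfolding x'_def diff_ge_0_iff_ge by (rule inf_le1)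
    have "0 \<le> inf (x m) ((c m * D) *\<^sub>R V i)"
      using x(1)[OF m(1)] V(1)[OF i] cD[of m] by (auto intro: scaleR_nonneg_nonneg)
    then show "x' m \<le> x m" unfolding x'_def by (simp only: diff_le_eq le_add_same_cancel1)
    show "\<theta> - \<delta> \<le> f m (x' m)"
      using \<theta>[OF m(1)] m(2) unfolding x'_def blinfun.diff_right by linarith
    \<comment> \<open>One vector separates both: \<open>y\<close> lies below its positive part
      because \<open>x m\<close> is at most \<open>c m\<close> times \<open>e\<close>, and
      \<open>x' m\<close> lies below a multiple of its negative part.\<close>
    define w where "w = V i - inverse (c m * D) *\<^sub>R x m"
    have "inverse (c m * D) *\<^sub>R x m \<le> inverse (c m * D) *\<^sub>R c m *\<^sub>R e"
      using c[of m] D by (intro scaleR_left_mono x m) auto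
    also have "\<dots> = inverse D *\<^sub>R e" using c[of m] by simp
    finally have "y \<le> pprt w" unfolding y_def w_def by (intro pprt_mono diff_mono) auto
    have "x' m = sup 0 (x m - (c m * D) *\<^sub>R V i)"
      unfolding x'_def diff_inf_eq_sup by (simp only: add_sup_distrib_left) simp
    also have "x m - (c m * D) *\<^sub>R V i = (c m * D) *\<^sub>R (- w)"
      using c[of m] D by (simp add: w_def scaleR_diff_right del: inverse_mult_distrib)
    finally have "x' m \<le> (c m * D) *\<^sub>R pprt (- w)"
      using pprt_scaleR_le[of "c m * D" "- w"] cD[of m] by (simp add: pprt_def sup_commute)
    moreover have "inf (pprt w) ((c m * D) *\<^sub>R pprt (- w)) = 0"
      using disjoint_scaleR[OF inf_pprt_pprt_uminus[of w], of 1 "c m * D"] cD[of m] by simp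
    ultimately show "inf y (x' m) = 0"
      using \<open>y \<le> pprt w\<close> \<open>0 \<le> y\<close> \<open>0 \<le> x' m\<close> by (auto intro: disjoint_mono)
  qed
qed

text \<open>Iterating \<open>disjoint_step\<close> selects one vector at a time and keeps infinitely
  many indices whose remaining vectors are disjoint from it. Summable losses preserve half of
  \<open>\<theta>\<close>.\<close>

lemma disjoint_functionals_disjoint_vectors:
  fixes f :: "nat \<Rightarrow> 'a::banach_lattice \<Rightarrow>\<^sub>L real"
  assumes f: "\<And>i. 0 \<le> f i" "\<And>i j. i \<noteq> j \<Longrightarrow> inf (f i) (f j) = 0" "\<And>i. norm (f i) \<le> K"
    and x: "\<And>i. 0 \<le> x i" "\<And>i. norm (x i) \<le> 1" and \<theta>: "0 < \<theta>" "\<And>i. \<theta> \<le> f i (x i)"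
  obtains i :: "nat \<Rightarrow> nat" and y
  where "disjoint_seq y" "\<And>k. 0 \<le> y k" "\<And>k. y k \<le> x (i k)" "\<And>k. \<theta> / 2 \<le> f (i k) (y k)"
proof -
  obtain e where e: "0 \<le> e" "\<And>n. x n \<le> 2 ^ Suc n *\<^sub>R e"
    by (rule common_bound[of x, OF x]) blast
  have K0: "0 \<le> K" using f(3)[of 0] norm_ge_zero order_trans by blast
  have bound: "f m z \<le> K * norm z" for m z
    using norm_blinfun[of "f m" z] mult_right_mono[OF f(3)[of m] norm_ge_zero[of z]] by simp
  \<comment> \<open>A state consists of the surviving indices and their trimmed vectors. The margin
    above \<open>\<theta> / 2\<close> starts at \<open>\<theta> / 2\<close> and halves at each
    stage.\<close>
  define P where "P k s \<longleftrightarrow> (case s of (M, X) \<Rightarrow> infinite M \<and>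
    (\<forall>m\<in>M. 0 \<le> X m \<and> X m \<le> x m \<and> \<theta> / 2 + \<theta> / 2 / 2 ^ k \<le> f m (X m)))"
    for k :: nat and s :: "nat set \<times> (nat \<Rightarrow> 'a)"
  define R where "R s t i y \<longleftrightarrow> i \<in> fst s \<and> 0 \<le> y \<and> y \<le> snd s i \<and> \<theta> / 2 \<le> blinfun_apply (f i) y \<and>
    fst t \<subseteq> fst s \<and> (\<forall>m\<in>fst t. snd t m \<le> snd s m \<and> inf y (snd t m) = 0)"
    for s t :: "nat set \<times> (nat \<Rightarrow> 'a)" and i y
  have "\<exists>s. P 0 s"
    using x(1) \<theta> by (intro exI[of _ "(UNIV, x)"]) (simp add: P_def)
  moreover have "\<exists>t. P (Suc k) t \<and> (\<exists>i y. R s t i y)" if "P k s" for k s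
  proof -
    obtain M X where s: "s = (M, X)" by (cases s)
    have M: "infinite M" and X: "\<And>m. m \<in> M \<Longrightarrow> 0 \<le> X m" "\<And>m. m \<in> M \<Longrightarrow> X m \<le> x m"
        "\<And>m. m \<in> M \<Longrightarrow> \<theta> / 2 + \<theta> / 2 / 2 ^ k \<le> f m (X m)"
      using that by (auto simp: P_def s)
    define K' where "K' = K * max 1 (norm e)"
    have Xe: "X m \<le> 2 ^ Suc m *\<^sub>R e" if "m \<in> M" for m
      using X(2)[OF that] e(2) by (rule order_trans)
    have XK: "f m (X m) \<le> K'" if "m \<in> M" for m
    proof -
      have "norm (X m) \<le> norm (x m)" using X that by (intro norm_mono_nonneg) auto
      then have "K * norm (X m) \<le> K'"
        unfolding K'_def using x(2)[of m] by (intro mult_left_mono K0) linarith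
      with bound show ?thesis by (rule order_trans)
    qed
    have eK: "f m e \<le> K'" for m
      using bound[of m e] mult_left_mono[of "norm e" "max 1 (norm e)" K] K0 by (simp add: K'_def)
    \<comment> \<open>Exactly half of the margin at stage \<open>k\<close>.\<close>
    have \<delta>: "0 < \<theta> / 4 / 2 ^ k" using \<theta> by simp
    obtain i y M' x' where *: "i \<in> M" "0 \<le> y" "y \<le> X i"
        "\<theta> / 2 + \<theta> / 2 / 2 ^ k - \<theta> / 4 / 2 ^ k \<le> f i y"
        "infinite M'" "M' \<subseteq> M" "\<And>m. m \<in> M' \<Longrightarrow> 0 \<le> x' m" "\<And>m. m \<in> M' \<Longrightarrow> x' m \<le> X m"
        "\<And>m. m \<in> M' \<Longrightarrow> \<theta> / 2 + \<theta> / 2 / 2 ^ k - \<theta> / 4 / 2 ^ k \<le> f m (x' m)"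
        "\<And>m. m \<in> M' \<Longrightarrow> inf y (x' m) = 0"
      by (rule disjoint_step[where f = f and x = X and c = "\<lambda>m. 2 ^ Suc m" and e = e and K = K',
          OF f(1,2) M X(1) Xe _ e(1) XK eK X(3) \<delta>]) (blast | simp)+
    have eq: "\<theta> / 2 + \<theta> / 2 / 2 ^ k - \<theta> / 4 / 2 ^ k = \<theta> / 2 + \<theta> / 2 / 2 ^ Suc k"
      by (simp add: field_simps)
    have "x' m \<le> x m" if "m \<in> M'" for m
      using *(6,8) X(2) that by (meson order_trans subsetD)
    then have "P (Suc k) (M', x')"
      unfolding P_def using *(5,7,9) unfolding eq by auto
    moreover have "\<theta> / 2 \<le> \<theta> / 2 + \<theta> / 2 / 2 ^ Suc k" using \<theta> by simp
    then have "R s (M', x') i y"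
      unfolding R_def s using *(1-4,6,8,10) unfolding eq by (auto intro: order_trans)
    ultimately show ?thesis by blast
  qed
  ultimately obtain s where s: "\<And>k. P k (s k)" "\<And>k. \<exists>i y. R (s k) (s (Suc k)) i y"
    using dependent_nat_choice[of P "\<lambda>_ s t. \<exists>i y. R s t i y"] by blast
  then obtain i y where R: "\<And>k. R (s k) (s (Suc k)) (i k) (y k)" by metis
  \<comment> \<open>States only shrink, so every later choice lies below a vector already disjoint
    from \<open>y k\<close>.\<close>
  have decr: "fst (s l) \<subseteq> fst (s k) \<and> (\<forall>m\<in>fst (s l). snd (s l) m \<le> snd (s k) m)" if "k \<le> l" for k l
    using that
  proof (induction l rule: dec_induct)
    case (step l)
    then show ?case using R[of l] unfolding R_def by (blast intro: order_trans)
  qed simp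
  have y: "0 \<le> y k" for k using R[of k] by (simp add: R_def)
  have disj: "inf (y k) (y l) = 0" if "k < l" for k l
  proof -
    have il: "i l \<in> fst (s (Suc k))" "y l \<le> snd (s (Suc k)) (i l)"
      using R[of l] decr[of "Suc k" l] that unfolding R_def by (auto intro: order_trans)
    then have "inf (y k) (snd (s (Suc k)) (i l)) = 0"
      using R[of k] by (simp add: R_def)
    then show ?thesis by (rule disjoint_mono) (use y il in auto)
  qed
  show ?thesis
  proof
    show "disjoint_seq y"
      unfolding disjoint_seq_def
    proof (intro allI impI)
      fix m n :: nat assume "m \<noteq> n"
      then show "inf \<bar>y m\<bar> \<bar>y n\<bar> = 0"
        using disj[of m n] disj[of n m] y by (cases m n rule: linorder_cases) (auto simp: inf_commute)
    qed
    fix k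
    show "0 \<le> y k" by (rule y)
    show "\<theta> / 2 \<le> f (i k) (y k)" using R[of k] by (simp add: R_def)
    have "y k \<le> snd (s k) (i k)" "i k \<in> fst (s k)" using R[of k] by (simp_all add: R_def)
    then show "y k \<le> x (i k)"
      using s(1)[of k] unfolding P_def by (cases "s k") (auto intro: order_trans)
  qed
qed

text \<open>Disjoint functionals of norm at least \<open>\<epsilon>\<close> produce disjoint vectors
  on which the dominating moduli \<open>\<bar>a n\<bar>\<close> stay large. Replacing each vector by
  a suitable \<open>u\<close> of no larger modulus passes from the modulus to \<open>a n\<close>
  itself.\<close>

lemma L_weakly_compact_dualI:
  fixes A :: "('a::banach_lattice \<Rightarrow>\<^sub>L real) set"
  assumes "A \<noteq> {}" "bounded A"
    and tendsto: "\<And>x a. disjoint_seq x \<Longrightarrow> range x \<subseteq> cball 0 1 \<Longrightarrow>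
      (\<And>n. a n \<in> A) \<Longrightarrow> (\<lambda>n. blinfun_apply (a n) (x n)) \<longlonglongrightarrow> 0"
  shows "L_weakly_compact A"
proof (rule L_weakly_compactI[OF assms(1,2)])
  fix g :: "nat \<Rightarrow> 'a \<Rightarrow>\<^sub>L real" and \<epsilon> :: real
  assume g: "disjoint_seq g" "range g \<subseteq> solid_hull A" and \<epsilon>: "0 < \<epsilon>" "\<And>n. \<epsilon> \<le> norm (g n)"
  have "\<forall>n. \<exists>a. a \<in> A \<and> \<bar>g n\<bar> \<le> \<bar>a\<bar>" using g(2) by (auto simp: solid_hull_def)
  then obtain a where a: "\<And>n. a n \<in> A" "\<And>n. \<bar>g n\<bar> \<le> \<bar>a n\<bar>" by metis
  obtain K where K: "\<And>a. a \<in> A \<Longrightarrow> norm a \<le> K" using assms(2) by (auto simp: bounded_iff)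
  define f where "f n = \<bar>g n\<bar>" for n
  have f: "0 \<le> f n" "norm (f n) \<le> K" for n
    using norm_mono_abs[OF a(2)[of n]] K[OF a(1)[of n]] by (simp_all add: f_def norm_abs_eq)
  have f_disj: "inf (f i) (f j) = 0" if "i \<noteq> j" for i j
    using g(1) that by (simp add: disjoint_seq_def f_def)
  have "\<exists>x. 0 \<le> x \<and> norm x \<le> 1 \<and> \<epsilon> / 2 \<le> blinfun_apply (f n) x" for n
  proof -
    have "\<epsilon> / 2 < norm (f n)" using \<epsilon>(1) \<epsilon>(2)[of n] by (simp add: f_def norm_abs_eq)
    then show ?thesis
      using \<epsilon>(1) dual_norm_approx[OF f(1)[of n], of "\<epsilon> / 2"] by (metis half_gt_zero less_imp_le)
  qed
  then obtain x where x: "\<And>n. 0 \<le> x n" "\<And>n. norm (x n) \<le> 1" "\<And>n. \<epsilon> / 2 \<le> f n (x n)"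
    by metis
  obtain i y where y: "disjoint_seq y" "\<And>k. 0 \<le> y k" "\<And>k. y k \<le> x (i k)"
      "\<And>k. \<epsilon> / 2 / 2 \<le> f (i k) (y k)"
    by (rule disjoint_functionals_disjoint_vectors[where f = f and x = x,
        OF f(1) f_disj f(2) x(1,2) half_gt_zero[OF \<epsilon>(1)] x(3)]) blast+
  \<comment> \<open>The vectors \<open>y k\<close> retain \<open>\<epsilon> / 4\<close>;
    approximating the modulus to within \<open>\<epsilon> / 8\<close> leaves more than
    \<open>\<epsilon> / 8\<close>.\<close>
  have "\<exists>u. \<bar>u\<bar> \<le> y k \<and> \<epsilon> / 8 < blinfun_apply (a (i k)) u" for k
  proof -
    obtain u where "\<bar>u\<bar> \<le> y k" "\<bar>a (i k)\<bar> (y k) - \<epsilon> / 8 < a (i k) u"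
      using dual_abs_approx[OF y(2), of "\<epsilon> / 8"] \<epsilon>(1) by auto
    moreover have "f (i k) (y k) \<le> \<bar>a (i k)\<bar> (y k)"
      unfolding f_def by (intro dual_le_apply a y)
    ultimately show ?thesis using y(4)[of k] by (intro exI[of _ u]) auto
  qed
  then obtain u where u: "\<And>k. \<bar>u k\<bar> \<le> y k" "\<And>k. \<epsilon> / 8 < a (i k) (u k)"
    by metis
  have "disjoint_seq u"
    by (rule disjoint_seq_abs_mono[OF y(1)]) (use u(1) y(2) in simp)
  moreover have "norm (u k) \<le> 1" for k
  proof -
    have "norm (u k) \<le> norm (y k)" using u(1)[of k] y(2)[of k] by (intro norm_mono_abs) simp
    also have "\<dots> \<le> norm (x (i k))" by (intro norm_mono_nonneg y)
    also have "\<dots> \<le> 1" by (rule x)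
    finally show ?thesis .
  qed
  then have "range u \<subseteq> cball 0 1" by auto
  ultimately have "(\<lambda>k. a (i k) (u k)) \<longlonglongrightarrow> 0" by (rule tendsto) (rule a)
  then have "\<epsilon> / 8 \<le> 0"
    by (rule tendsto_lowerbound) (use u(2) in \<open>auto intro!: always_eventually less_imp_le\<close>)
  then show False using \<epsilon>(1) by simp
qed

section \<open>Duality of the two compactness notions\<close>

lemma bounded_image_interval:
  fixes T :: "'a::banach_lattice \<Rightarrow>\<^sub>L 'b::real_normed_vector"
  shows "bounded (T ` {0..x})"
proof -
  have "bounded {0..x}"
    unfolding bounded_iff by (intro exI[of _ "norm x"]) (auto intro: norm_mono_nonneg)
  then show ?thesis by (rule bounded_linear_image) (rule blinfun.bounded_linear_right)
qed

lemma order_M_weakly_compact_if_adjoint: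
  fixes T :: "'e::banach_lattice \<Rightarrow>\<^sub>L 'f::banach_lattice"
  assumes "order_L_weakly_compact (dual_adjoint T)"
  shows "order_M_weakly_compact T"
  unfolding order_M_weakly_compact_def
proof (intro allI impI, elim conjE)
  fix x :: "nat \<Rightarrow> 'e" and f :: "nat \<Rightarrow> 'f \<Rightarrow>\<^sub>L real"
  assume x: "disjoint_seq x" "range x \<subseteq> cball 0 1" and "order_bounded (range f)"
  then obtain a b where ab: "\<And>n. a \<le> f n" "\<And>n. f n \<le> b"
    unfolding order_bounded_def by fastforce
  have lim: "(\<lambda>n. h n (T (x n))) \<longlonglongrightarrow> 0" if "\<And>n. 0 \<le> h n" "\<And>n. h n \<le> c"
    for h :: "nat \<Rightarrow> 'f \<Rightarrow>\<^sub>L real" and c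
  proof -
    have "0 \<le> c" using that[of 0] by (rule order_trans)
    then have "L_weakly_compact (dual_adjoint T ` {0..c})"
      using assms by (simp add: order_L_weakly_compact_def)
    then have "(\<lambda>n. dual_adjoint T (h n) (x n)) \<longlonglongrightarrow> 0"
      by (rule L_weakly_compact_dual_tendsto) (use x that in auto)
    then show ?thesis by (simp add: dual_adjoint.rep_eq)
  qed
  \<comment> \<open>An arbitrary order interval is reduced to intervals starting at zero:
    \<open>f n - a\<close> lies in \<open>[0, b - a]\<close>, and \<open>a\<close> is the difference
    of its two parts.\<close>
  have "(\<lambda>n. (f n - a) (T (x n)) + pprt a (T (x n)) - pprt (- a) (T (x n))) \<longlonglongrightarrow> 0 + 0 - 0"
    using ab by (intro tendsto_diff tendsto_add lim[of _ "b - a"] lim[of _ "pprt a"] lim[of _ "pprt (- a)"])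
      (auto intro: diff_mono)
  moreover have "f n = (f n - a) + pprt a - pprt (- a)" for n
    using pprt_diff[of a] by (simp add: algebra_simps)
  then have "f n (T (x n)) = (f n - a) (T (x n)) + pprt a (T (x n)) - pprt (- a) (T (x n))" for n
    by (metis blinfun.add_left blinfun.diff_left)
  ultimately show "(\<lambda>n. f n (T (x n))) \<longlonglongrightarrow> 0" by simp
qed

text \<open>Elements of the image of \<open>[0, c]\<close> are \<open>h\<close> composed with
  \<open>T\<close>, so sequences in it come from order bounded sequences of functionals.\<close>

lemma adjoint_order_L_weakly_compact:
  fixes T :: "'e::banach_lattice \<Rightarrow>\<^sub>L 'f::banach_lattice"
  assumes "order_M_weakly_compact T"
  shows "order_L_weakly_compact (dual_adjoint T)"
  unfolding order_L_weakly_compact_def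
proof (intro allI impI L_weakly_compact_dualI bounded_image_interval)
  fix c :: "'f \<Rightarrow>\<^sub>L real" assume "0 \<le> c"
  then show "dual_adjoint T ` {0..c} \<noteq> {}" by auto
  fix x :: "nat \<Rightarrow> 'e" and a :: "nat \<Rightarrow> 'e \<Rightarrow>\<^sub>L real"
  assume x: "disjoint_seq x" "range x \<subseteq> cball 0 1" and "\<And>n. a n \<in> dual_adjoint T ` {0..c}"
  then have "\<forall>n. \<exists>h. h \<in> {0..c} \<and> a n = dual_adjoint T h" by blast
  then obtain h where h: "\<And>n. h n \<in> {0..c}" "\<And>n. a n = dual_adjoint T (h n)" by metis
  have "order_bounded (range h)"
    unfolding order_bounded_def using h(1) by blast
  then have "(\<lambda>n. h n (T (x n))) \<longlonglongrightarrow> 0"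
    using assms x unfolding order_M_weakly_compact_def by blast
  then show "(\<lambda>n. a n (x n)) \<longlonglongrightarrow> 0" by (simp add: h(2) dual_adjoint.rep_eq)
qed

lemma order_L_weakly_compact_if_adjoint:
  fixes T :: "'e::banach_lattice \<Rightarrow>\<^sub>L 'f::banach_lattice"
  assumes "order_M_weakly_compact (dual_adjoint T)"
  shows "order_L_weakly_compact T"
  unfolding order_L_weakly_compact_def
proof (intro allI impI L_weakly_compactI_dual bounded_image_interval)
  fix c :: 'e assume c: "0 \<le> c"
  then show "T ` {0..c} \<noteq> {}" by auto
  fix g :: "nat \<Rightarrow> 'f \<Rightarrow>\<^sub>L real" and a :: "nat \<Rightarrow> 'f"
  assume g: "disjoint_seq g" "range g \<subseteq> cball 0 1" and "\<And>n. a n \<in> T ` {0..c}"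
  then have "\<forall>n. \<exists>h. h \<in> {0..c} \<and> a n = T h" by blast
  then obtain h where h: "\<And>n. h n \<in> {0..c}" "\<And>n. a n = T (h n)" by metis
  \<comment> \<open>The canonical embedding into the bidual. It preserves order, so points of
    \<open>[0, c]\<close> become an order bounded sequence of functionals on the dual, to which the
    hypothesis on the adjoint applies.\<close>
  define ev :: "'e \<Rightarrow> ('e \<Rightarrow>\<^sub>L real) \<Rightarrow>\<^sub>L real" where "ev x = Blinfun (\<lambda>f. blinfun_apply f x)" for x
  have ev: "blinfun_apply (ev x) f = f x" for x f
    unfolding ev_def by (simp add: bounded_linear_Blinfun_apply blinfun.bounded_linear_left)
  have "ev (h n) \<in> {0..ev c}" for n
    using h(1)[of n] by (auto simp: less_eq_blinfun_def[where 'a = "'e \<Rightarrow>\<^sub>L real"] ev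
        intro: dual_apply_nonneg dual_apply_mono)
  then have "order_bounded (range (\<lambda>n. ev (h n)))"
    unfolding order_bounded_def by blast
  then have "(\<lambda>n. ev (h n) (dual_adjoint T (g n))) \<longlonglongrightarrow> 0"
    using assms g unfolding order_M_weakly_compact_def by blast
  then show "(\<lambda>n. g n (a n)) \<longlonglongrightarrow> 0" by (simp add: h(2) ev dual_adjoint.rep_eq)
qed

theorem theorem2p3:
  fixes T :: "'e::banach_lattice \<Rightarrow>\<^sub>L 'f::banach_lattice"
  shows "(order_M_weakly_compact T \<longleftrightarrow> order_L_weakly_compact (dual_adjoint T)) \<and>
    (order_M_weakly_compact (dual_adjoint T) \<longrightarrow> order_L_weakly_compact T)"
  using order_M_weakly_compact_if_adjoint adjoint_order_L_weakly_compact
    order_L_weakly_compact_if_adjoint by blast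

end
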